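(* Let $\mathcal{F}$ be a germ of a singular holomorphic foliation at $(\mathbb{C}^2,p)$ and let $C=\bigcup_{j=1}^r C_j$ be an $\mathcal{F}$-invariant reduced curve with irreducible components $C_1,\dots,C_r$. Then $$\tau_p(\mathcal{F},C)=\sum_{j=1}^r\tau_p(\mathcal{F},C_j)-\left(\sum_{1\le i<j\le r}I_p(C_i,C_j)\right)+\Theta .$$
   Context: A germ of singular holomorphic foliation $\mathcal{F}$ at $(\mathbb{C}^2,p)$ is given in coordinates $(x,y)$ centered at $p$ by a 1-form $\omega=P\,dx+Q\,dy$ with $P,Q\in\mathbb{C}\{x,y\}$ relatively prime and vanishing at $p$. A curve $C:f=0$, $f\in\mathbb{C}[[x,y]]$, is $\mathcal{F}$-invariant if $\omega\wedge df=f h\,dx\wedge dy$ for some $h\in\mathbb{C}[[x,y]]$. For an invariant reduced curve $C:f=0$, the Tjurina number of $\mathcal{F}$ with respect to $C$ is $\tau_p(\mathcal{F},C)=\dim_{\mathbb{C}}\mathbb{C}[[x,y]]/(P,Q,f)$. $I_p(C_i,C_j)$ denotes the intersection multiplicity at $p$, and $\tau_p(C)=\dim_{\mathbb{C}}\mathbb{C}[[x,y]]/(f,f_x,f_y)$ is the usual Tjurina number of the curve $C:f=0$. $\Theta$ is the integer, depending only on the curve $C$ (on its module of Kähler differentials) and not on $\mathcal{F}$, determined by $$\tau_p(C)=\sum_{j=1}^r\tau_p(C_j)+\left(\sum_{1\le i<j\le r}I_p(C_i,C_j)\right)+\Theta .$$ *)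

theory Defs
  imports
    "HOL-Analysis.Analysis"
    "HOL-Computational_Algebra.Computational_Algebra"
begin

text \<open>
  The ring of formal power series in \<open>x, y\<close> over the complex numbers is rendered as
  power series in \<open>y\<close> whose coefficients are power series in \<open>x\<close>:
  the coefficient of \<open>x\<^sup>i y\<^sup>j\<close> in \<open>F\<close> is \<open>F $ j $ i\<close>.
\<close>

type_synonym series2 = "complex fps fps"

definition const2 :: "complex \<Rightarrow> series2" where
  "const2 c = fps_const (fps_const c)"

definition value0 :: "series2 \<Rightarrow> complex" where
  "value0 F = F $ 0 $ 0"

definition deriv_x :: "series2 \<Rightarrow> series2" where
  "deriv_x F = Abs_fps (\<lambda>j. fps_deriv (F $ j))"

definition deriv_y :: "series2 \<Rightarrow> series2" where
  "deriv_y F = fps_deriv F"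

text \<open>The subring of series converging in a neighbourhood of the origin.
  For complex families \<open>summable_on\<close> is absolute summability.\<close>

definition convergent_series2 :: "series2 set" where
  "convergent_series2 =
     {F. \<exists>e>0. \<forall>x y. norm x < e \<longrightarrow> norm y < e \<longrightarrow>
           (\<lambda>(i, j). F $ j $ i * x ^ i * y ^ j) summable_on UNIV}"

text \<open>Relative primality inside a subring \<open>A\<close>: both divisibility and being a unit are
  understood in \<open>A\<close>, not in the ambient ring.\<close>

definition relatively_prime_in :: "series2 set \<Rightarrow> series2 \<Rightarrow> series2 \<Rightarrow> bool" where
  "relatively_prime_in A P Q \<longleftrightarrow>
     (\<forall>c\<in>A. (\<exists>a\<in>A. P = c * a) \<longrightarrow> (\<exists>b\<in>A. Q = c * b) \<longrightarrow> (\<exists>d\<in>A. c * d = 1))"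

text \<open>\<open>P\<close> and \<open>Q\<close> are the coefficients of the 1-form \<open>P dx + Q dy\<close>.\<close>

definition singular_foliation :: "series2 \<Rightarrow> series2 \<Rightarrow> bool" where
  "singular_foliation P Q \<longleftrightarrow>
     P \<in> convergent_series2 \<and> Q \<in> convergent_series2 \<and>
     relatively_prime_in convergent_series2 P Q \<and>
     value0 P = 0 \<and> value0 Q = 0"

text \<open>\<open>(P dx + Q dy) \<and> df = (P f\<^sub>y - Q f\<^sub>x) dx \<and> dy\<close>.\<close>

definition invariant_curve :: "series2 \<Rightarrow> series2 \<Rightarrow> series2 \<Rightarrow> bool" where
  "invariant_curve P Q f \<longleftrightarrow> (\<exists>h. P * deriv_y f - Q * deriv_x f = f * h)"

text \<open>A reduced curve germ through the origin is given by a squarefree equation; its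
  irreducible components \<open>g 1, \<dots>, g r\<close> are the irreducible factors of the equation, each
  of which is only determined up to a unit.  They are pairwise non-associated because
  \<open>f\<close> is squarefree.\<close>

definition reduced_curve :: "series2 \<Rightarrow> bool" where
  "reduced_curve f \<longleftrightarrow> value0 f = 0 \<and> squarefree f"

definition irreducible_components :: "series2 \<Rightarrow> nat \<Rightarrow> (nat \<Rightarrow> series2) \<Rightarrow> bool" where
  "irreducible_components f r g \<longleftrightarrow>
     (\<forall>j\<in>{1..r}. irreducible (g j)) \<and> (\<exists>u. u dvd 1 \<and> f = u * (\<Prod>j=1..r. g j))"

definition ideal_generated :: "series2 set \<Rightarrow> series2 set" where
  "ideal_generated S = module.span (*) S"

text \<open>The residue classes of the elements of \<open>B\<close> modulo the ideal \<open>I\<close> form a basis of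
  the complex vector space of all residue classes: every class is a unique linear
  combination of them.\<close>

definition quotient_basis :: "series2 set \<Rightarrow> series2 set \<Rightarrow> bool" where
  "quotient_basis I B \<longleftrightarrow>
     finite B \<and>
     (\<forall>g. \<exists>c. g - (\<Sum>b\<in>B. const2 (c b) * b) \<in> I) \<and>
     (\<forall>c. (\<Sum>b\<in>B. const2 (c b) * b) \<in> I \<longrightarrow> (\<forall>b\<in>B. c b = 0))"

text \<open>As for \<open>card\<close> and \<open>dim\<close>, the value is 0 by convention if the quotient is
  infinite-dimensional.  This does not occur for the invariants below: for a singular
  foliation, a reduced curve and two distinct irreducible components, respectively,
  all these dimensions are finite.\<close>

definition quotient_dim :: "series2 set \<Rightarrow> nat" where
  "quotient_dim I =
     (if \<exists>B. quotient_basis I B then THE n. \<exists>B. quotient_basis I B \<and> card B = n else 0)"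

definition tjurina_foliation :: "series2 \<Rightarrow> series2 \<Rightarrow> series2 \<Rightarrow> nat" where
  "tjurina_foliation P Q f = quotient_dim (ideal_generated {P, Q, f})"

definition tjurina_curve :: "series2 \<Rightarrow> nat" where
  "tjurina_curve f = quotient_dim (ideal_generated {f, deriv_x f, deriv_y f})"

definition intersection_multiplicity :: "series2 \<Rightarrow> series2 \<Rightarrow> nat" where
  "intersection_multiplicity f g = quotient_dim (ideal_generated {f, g})"

definition Theta :: "series2 \<Rightarrow> nat \<Rightarrow> (nat \<Rightarrow> series2) \<Rightarrow> int" where
  "Theta f r g = (THE t::int.
     int (tjurina_curve f) =
       (\<Sum>j=1..r. int (tjurina_curve (g j))) +
       (\<Sum>(i, j)\<in>{(i, j). 1 \<le> i \<and> i < j \<and> j \<le> r}. int (intersection_multiplicity (g i) (g j))) +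
       t)"

end

theory Submission
  imports Defs
begin

text \<open>
  Write \<open>O = \<complex>[[x,y]]\<close>. For a generic constant \<open>t\<close> put \<open>D = \<partial>\<^sub>x + t \<partial>\<^sub>y\<close> and
  \<open>q = P + t Q\<close>. Invariance of \<open>f\<close> says that modulo \<open>f\<close> the vectors \<open>(P, Q)\<close> and
  \<open>(f\<^sub>x, f\<^sub>y)\<close> are proportional, hence so are \<open>(q, Q)\<close> and \<open>(D f, f\<^sub>y)\<close>:
  \<open>Q \<cdot> D f \<equiv> q \<cdot> f\<^sub>y\<close>. If \<open>q\<close> and \<open>D f\<close> are non-zero-divisors modulo \<open>f\<close>, it
  follows that the annihilators of the class of \<open>Q\<close> in \<open>O/(f,q)\<close> and of the class of \<open>f\<^sub>y\<close> in
  \<open>O/(f,D f)\<close> are the same ideal. The two principal submodules generated by these classes are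
  therefore isomorphic, and comparing dimensions gives
  \<open>\<tau>(F,f) - \<tau>(f) = I(f,q) - I(f,D f)\<close>.
  (This is the formula of Gomez-Mont; the right-hand side is the GSV index of the foliation.)
  See \<open>tjurina_exchange\<close>.

  The right-hand side is easy to follow under factorization. Let \<open>f = u g\<^sub>1 \<dots> g\<^sub>r\<close>.
  Intersection numbers are additive in \<open>f\<close>, so \<open>I(f,q) = \<Sum>\<^sub>j I(g\<^sub>j,q)\<close>, whereas by the Leibniz
  rule \<open>D f\<close> is congruent to \<open>u (\<Prod>\<^sub>i\<^sub>\<noteq>\<^sub>j g\<^sub>i) D g\<^sub>j\<close> modulo \<open>g\<^sub>j\<close>, so that
  \<open>I(f,D f) = \<Sum>\<^sub>j (I(g\<^sub>j,D g\<^sub>j) + \<Sum>\<^sub>i\<^sub>\<noteq>\<^sub>j I(g\<^sub>i,g\<^sub>j))\<close>. The difference between \<open>f\<close> and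
  its components is thus \<open>- 2 \<Sum>\<^sub>i\<^sub><\<^sub>j I(g\<^sub>i,g\<^sub>j)\<close>, of which the definition of
  \<open>\<Theta>\<close> restores one half.

  Two things have to be supplied for this to make sense. All dimensions are finite because every
  ideal that occurs contains powers of both variables, and if the ideal \<open>(g, k)\<close> does so, then
  \<open>k\<close> is a non-zero-divisor modulo \<open>g\<close> (\<open>dvd_of_dvd_mult_m_primary\<close>). That two relatively prime series
  generate such an ideal is \<open>m_primary_of_relatively_prime\<close>. It has to be known twice: in \<open>O\<close>,
  for the components of \<open>f\<close>, and in the ring of convergent series, because
  \<open>P\<close> and \<open>Q\<close> are supposed to be relatively prime in the latter. Both cases follow from
  Weierstrass division, whose quotient is shown to converge when the data do.
\<close>

unbundle no vec_syntax

section \<open>Coefficients, ideals and the complex vector space structure\<close>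

definition var_x :: series2 where "var_x = fps_const fps_X"
definition var_y :: series2 where "var_y = fps_X"

lemma coeff_var_x_power: "(var_x ^ n * F) $ j $ i = (if i < n then 0 else F $ j $ (i - n))"
  by (simp add: var_x_def fps_const_power fps_X_power_mult_nth)

lemma coeff_var_y_power: "(var_y ^ n * F) $ j = (if j < n then 0 else F $ (j - n))"
  by (simp add: var_y_def fps_X_power_mult_nth)

lemma coeff_mult: "(F * G) $ j $ i = (\<Sum>b\<le>j. \<Sum>a\<le>i. F $ b $ a * G $ (j - b) $ (i - a))"
  for F G :: series2
  by (simp add: fps_mult_nth fps_sum_nth atLeast0AtMost)

lemma coeff_const2_mult: "(const2 c * F) $ j $ i = c * F $ j $ i"
  by (simp add: const2_def)

lemma const2_0 [simp]: "const2 0 = 0" and const2_1 [simp]: "const2 1 = 1"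
  and const2_minus_1 [simp]: "const2 (- 1) = - 1"
  by (simp_all add: const2_def flip: fps_const_neg)

lemma coeff_pure_var_y_power: "(var_y ^ n) $ j = (if j = n then 1 else 0)"
  by (auto simp: var_y_def fps_X_power_nth)

lemma var_x_power_dvd_iff: "var_x ^ n dvd F \<longleftrightarrow> (\<forall>j. \<forall>i<n. F $ j $ i = 0)"
proof
  assume "\<forall>j. \<forall>i<n. F $ j $ i = 0"
  then have "F = var_x ^ n * Abs_fps (\<lambda>j. Abs_fps (\<lambda>i. F $ j $ (i + n)))"
    by (auto simp: fps_eq_iff coeff_var_x_power)
  then show "var_x ^ n dvd F" by (metis dvd_triv_left)
qed (auto simp: coeff_var_x_power elim!: dvdE)

lemma var_x_nz: "var_x \<noteq> 0" by (simp add: var_x_def)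

text \<open>
  The reason is that \<open>x\<^sup>n\<close> and \<open>y\<^sup>n\<close> form a regular sequence.
  If \<open>x\<^sup>n a = g b\<close> and \<open>y\<^sup>n a = g b'\<close>, then \<open>y\<^sup>n b = x\<^sup>n b'\<close>, so
  \<open>x\<^sup>n\<close> divides \<open>b\<close>, and it can be cancelled in the first equation.
\<close>

lemma dvd_of_dvd_var_x_var_y_multiples:
  assumes "g dvd var_x ^ n * a" "g dvd var_y ^ n * a" 
  shows "g dvd a"
proof (cases "g = 0")
  case True then show ?thesis using assms var_x_nz by auto
next
  case False
  obtain b where b: "var_x ^ n * a = g * b" using assms(1) by blast
  obtain b' where b': "var_y ^ n * a = g * b'" using assms(2) by blast
  have "g * (var_y ^ n * b) = var_y ^ n * (var_x ^ n * a)" by (metis b mult.left_commute)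
  also have "\<dots> = g * (var_x ^ n * b')" by (metis b' mult.left_commute)
  finally have eq: "var_y ^ n * b = var_x ^ n * b'" using False by simp
  have "b $ j $ i = 0" if "i < n" for i j
  proof -
    have "b $ j $ i = (var_y ^ n * b) $ (j + n) $ i" by (simp add: coeff_var_y_power)
    also have "\<dots> = 0" unfolding eq using that by (simp add: coeff_var_x_power)
    finally show ?thesis .
  qed
  then obtain c where "b = var_x ^ n * c" using var_x_power_dvd_iff[of n b] by (auto elim!: dvdE)
  then have "var_x ^ n * a = var_x ^ n * (g * c)" by (metis b mult.left_commute)
  then have "a = g * c" using var_x_nz by simp
  then show ?thesis by simp
qed

text \<open>
  With these two interpretations \<open>ideal.subspace I\<close> says that \<open>I\<close> is an ideal, and the
  linear algebra over the complex numbers is available under \<open>cvec\<close>.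
\<close>

interpretation ideal: module "(*) :: series2 \<Rightarrow> series2 \<Rightarrow> series2"
  by unfold_locales (simp_all only: distrib_left distrib_right mult.assoc mult_1_left)

interpretation cvec: vector_space "\<lambda>c (F::series2). const2 c * F"
proof
  fix a b :: complex and F G :: series2
  show "const2 a * (F + G) = const2 a * F + const2 a * G" by (rule distrib_left)
  have "const2 (a + b) = const2 a + const2 b" "const2 (a * b) = const2 a * const2 b"
    by (simp_all add: const2_def)
  then show "const2 (a + b) * F = const2 a * F + const2 b * F"
    and "const2 a * (const2 b * F) = const2 (a * b) * F"
    by (simp_all only: distrib_right mult.assoc)
  show "const2 1 * F = F" by (simp add: const2_def)
qed

lemma ideal_generated_3: "ideal_generated {a, b, c} = {p * a + q * b + s * c | p q s. True}"
proof -
  have "z \<in> ideal_generated {a, b, c} \<longleftrightarrow> (\<exists>p q s. z = p * a + q * b + s * c)" for z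
  proof -
    have "z \<in> ideal_generated {a, b, c} \<longleftrightarrow> (\<exists>p q s. z - p * a - q * b - s * c = 0)"
      unfolding ideal_generated_def ideal.span_insert ideal.span_empty by simp
    also have "\<dots> \<longleftrightarrow> (\<exists>p q s. z = p * a + q * b + s * c)"
      by (simp only: diff_diff_eq right_minus_eq)
    finally show ?thesis .
  qed
  then show ?thesis by blast
qed

lemma ideal_generated_2: "ideal_generated {a, b} = {p * a + q * b | p q. True}"
proof -
  have "ideal_generated {a, b} = ideal_generated {a, b, b}" by simp
  also have "\<dots> = {p * a + q * b | p q. True}"
  proof -
    have "\<exists>p' q'. p * a + q * b + s * b = p' * a + q' * b" for p q s
      by (intro exI[of _ p] exI[of _ "q + s"]) (simp add: distrib_right add.assoc)
    moreover have "\<exists>p' q' s'. p * a + q * b = p' * a + q' * b + s' * b" for p q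
      by (intro exI[of _ p] exI[of _ q] exI[of _ 0]) simp
    ultimately show ?thesis unfolding ideal_generated_3 by blast
  qed
  finally show ?thesis .
qed

lemma ideal_subspace [simp]: "ideal.subspace (ideal_generated S)"
  by (simp add: ideal_generated_def)

section \<open>Dimensions of quotients\<close>

text \<open>
  For proper ideals this says that \<open>I\<close> is primary to the maximal ideal \<open>(x, y)\<close>; the
  unit ideal is included.
\<close>

definition m_primary :: "series2 set \<Rightarrow> bool" where
  "m_primary I \<longleftrightarrow> (\<exists>n. var_x ^ n \<in> I \<and> var_y ^ n \<in> I)"

text \<open>
  Steinitz exchange modulo \<open>I\<close>: replacing every element of \<open>B'\<close> by its representative in
  the span of \<open>B\<close> loses nothing, because a linear relation between the representatives is a
  relation between the elements of \<open>B'\<close> modulo \<open>I\<close>.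
\<close>

lemma quotient_basis_card_le:
  assumes I: "ideal.subspace I" and B: "quotient_basis I B" and B': "quotient_basis I B'"
  shows "card B' \<le> card B"
proof -
  have "\<forall>g. \<exists>c. g - (\<Sum>b\<in>B. const2 (c b) * b) \<in> I" using B by (simp add: quotient_basis_def)
  then obtain c where c: "\<And>g. g - (\<Sum>b\<in>B. const2 (c g b) * b) \<in> I" by metis
  define \<phi> where "\<phi> g = (\<Sum>b\<in>B. const2 (c g b) * b)" for g
  have fin: "finite B" "finite B'" using B B' by (auto simp: quotient_basis_def)
  have ind: "d b = 0" if "(\<Sum>b\<in>B'. const2 (d b) * \<phi> b) = 0" "b \<in> B'" for d b
  proof -
    have "(\<Sum>b\<in>B'. const2 (d b) * (b - \<phi> b)) \<in> I"
      by (intro ideal.subspace_sum[OF I] ideal.subspace_scale[OF I]) (simp add: \<phi>_def c)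
    then have "(\<Sum>b\<in>B'. const2 (d b) * b) \<in> I"
      by (simp add: right_diff_distrib sum_subtractf that(1))
    then show ?thesis using B' that(2) by (simp add: quotient_basis_def)
  qed
  have inj: "inj_on \<phi> B'"
  proof (rule inj_onI, rule ccontr)
    fix u v assume uv: "u \<in> B'" "v \<in> B'" "\<phi> u = \<phi> v" "u \<noteq> v"
    let ?d = "\<lambda>b. if b = u then 1 else if b = v then -1 else (0::complex)"
    have "(\<Sum>b\<in>B'. const2 (?d b) * \<phi> b) = (\<Sum>b\<in>{u,v}. const2 (?d b) * \<phi> b)"
      by (rule sum.mono_neutral_right) (use fin uv in \<open>auto simp: const2_def\<close>)
    also have "\<dots> = 0" using uv by (simp add: const2_def flip: fps_const_neg)
    finally show False using ind[of ?d u] uv by simp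
  qed
  have "cvec.independent (\<phi> ` B')"
  proof (rule cvec.independent_if_scalars_zero)
    fix d x assume d: "(\<Sum>x\<in>\<phi> ` B'. const2 (d x) * x) = 0" "x \<in> \<phi> ` B'"
    then show "d x = 0" using ind[of "d \<circ> \<phi>"] by (auto simp: sum.reindex[OF inj])
  qed (use fin in auto)
  moreover have "\<phi> ` B' \<subseteq> cvec.span B"
    unfolding \<phi>_def by (intro image_subsetI cvec.span_sum cvec.span_scale cvec.span_base)
  ultimately have "card (\<phi> ` B') \<le> card B"
    using cvec.independent_span_bound[OF fin(1)] by blast
  then show ?thesis by (simp add: card_image inj)
qed

lemma quotient_dim_eq_card:
  assumes "ideal.subspace I" "quotient_basis I B"
  shows "quotient_dim I = card B"
proof -
  have "card B' = card B" if "quotient_basis I B'" for B'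
    by (intro antisym quotient_basis_card_le[OF assms(1)] that assms(2))
  then have "(THE n. \<exists>B. quotient_basis I B \<and> card B = n) = card B"
    using assms(2) by (intro the_equality) blast+
  then show ?thesis unfolding quotient_dim_def using assms(2) by presburger
qed

lemma series2_truncation:
  "\<exists>A B. F = (\<Sum>(i,j)\<in>{..<n}\<times>{..<n}. const2 (F $ j $ i) * (var_x ^ i * var_y ^ j)) + var_x ^ n * A + var_y ^ n * B"
proof -
  let ?S = "\<Sum>(i,j)\<in>{..<n}\<times>{..<n}. const2 (F $ j $ i) * (var_x ^ i * var_y ^ j)"
  have mono: "(const2 c * (var_x ^ i * var_y ^ j)) $ l $ k = (if l = j \<and> k = i then c else 0)" for c i j l k
    unfolding coeff_const2_mult coeff_var_x_power coeff_pure_var_y_power by simp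
  have S: "?S $ l $ k = (if l < n \<and> k < n then F $ l $ k else 0)" for l k
  proof -
    have "?S $ l $ k = (\<Sum>p\<in>{..<n}\<times>{..<n}. if p = (k, l) then F $ l $ k else 0)"
      unfolding fps_sum_nth case_prod_beta mono by (rule sum.cong) auto
    then show ?thesis by (simp add: sum.delta)
  qed
  define A where "A = Abs_fps (\<lambda>j. if j < n then Abs_fps (\<lambda>i. F $ j $ (i + n)) else 0)"
  define B where "B = Abs_fps (\<lambda>j. F $ (j + n))"
  have "F = ?S + var_x ^ n * A + var_y ^ n * B"
    unfolding fps_eq_iff fps_add_nth S coeff_var_x_power coeff_var_y_power A_def B_def by auto
  then show ?thesis by blast
qed

text \<open>
  The finitely many monomials outside \<open>(x\<^sup>n, y\<^sup>n)\<close> span the quotient, and a spanning set of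
  least cardinality is a basis.
\<close>

lemma quotient_basis_exists:
  assumes I: "ideal.subspace I" and prim: "m_primary I"
  shows "\<exists>B. quotient_basis I B"
proof -
  define spans where "spans B \<longleftrightarrow> finite B \<and> (\<forall>g. \<exists>c. g - (\<Sum>b\<in>B. const2 (c b) * b) \<in> I)" for B
  obtain n where n: "var_x ^ n \<in> I" "var_y ^ n \<in> I" using prim by (auto simp: m_primary_def)
  let ?m = "\<lambda>(i,j). var_x ^ i * var_y ^ j"
  let ?N = "{..<n} \<times> {..<n}"
  have inj: "inj_on ?m ?N"
  proof (rule inj_onI, clarify)
    fix i j k l :: nat assume eq: "var_x ^ i * var_y ^ j = var_x ^ k * var_y ^ l"
    have "(var_x ^ i * var_y ^ j) $ j $ i = 1" 
      by (simp add: coeff_var_x_power coeff_pure_var_y_power)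
    then have "(var_x ^ k * var_y ^ l) $ j $ i = 1" by (simp add: eq)
    then show "i = k \<and> j = l"
      by (auto simp: coeff_var_x_power coeff_pure_var_y_power split: if_splits)
  qed
  have "spans (?m ` ?N)"
    unfolding spans_def
  proof (intro conjI allI)
    fix g
    obtain A B where AB: "g = (\<Sum>(i,j)\<in>?N. const2 (g $ j $ i) * (var_x ^ i * var_y ^ j)) + var_x ^ n * A + var_y ^ n * B"
      using series2_truncation by blast
    let ?c = "\<lambda>b. (\<lambda>(i,j). g $ j $ i) (the_inv_into ?N ?m b)"
    have "(\<Sum>b\<in>?m ` ?N. const2 (?c b) * b) = (\<Sum>p\<in>?N. const2 (?c (?m p)) * ?m p)"
      by (subst sum.reindex[OF inj]) simp
    also have "\<dots> = (\<Sum>p\<in>?N. const2 (case p of (i, j) \<Rightarrow> g $ j $ i) * ?m p)"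
      by (intro sum.cong refl) (simp only: the_inv_into_f_f[OF inj])
    also have "\<dots> = (\<Sum>(i,j)\<in>?N. const2 (g $ j $ i) * (var_x ^ i * var_y ^ j))"
      by (intro sum.cong refl) (simp only: case_prod_beta)
    finally have "(\<Sum>b\<in>?m ` ?N. const2 (?c b) * b) = (\<Sum>(i,j)\<in>?N. const2 (g $ j $ i) * (var_x ^ i * var_y ^ j))" .
    then have "g - (\<Sum>b\<in>?m ` ?N. const2 (?c b) * b) = A * var_x ^ n + B * var_y ^ n"
      using AB by (simp only: mult.commute[of A] mult.commute[of B]) (simp only: diff_eq_eq ac_simps)
    also have "\<dots> \<in> I" using I n by (intro ideal.subspace_add ideal.subspace_scale)
    finally show "\<exists>c. g - (\<Sum>b\<in>?m ` ?N. const2 (c b) * b) \<in> I" by (intro exI)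
  qed simp
  then obtain B where B: "spans B" and min: "\<And>B'. spans B' \<Longrightarrow> card B \<le> card B'"
    using ex_has_least_nat[of spans _ card] by blast
  have finB: "finite B" using B by (simp add: spans_def)
  have "d b0 = 0" if d: "(\<Sum>b\<in>B. const2 (d b) * b) \<in> I" and b0: "b0 \<in> B" for d b0
  proof (rule ccontr)
    assume nz: "d b0 \<noteq> 0"
    have "spans (B - {b0})"
      unfolding spans_def
    proof (intro conjI allI)
      fix g
      obtain c where c: "g - (\<Sum>b\<in>B. const2 (c b) * b) \<in> I" using B by (auto simp: spans_def)
      define s where "s = c b0 / d b0"
      have "g - (\<Sum>b\<in>B. const2 (c b) * b) + const2 s * (\<Sum>b\<in>B. const2 (d b) * b) \<in> I"
        using I c d by (intro ideal.subspace_add ideal.subspace_scale)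
      also have "g - (\<Sum>b\<in>B. const2 (c b) * b) + const2 s * (\<Sum>b\<in>B. const2 (d b) * b)
         = g - (\<Sum>b\<in>B. const2 (c b - s * d b) * b)"
      proof -
        have "const2 (c b - s * d b) * b = const2 (c b) * b - const2 s * (const2 (d b) * b)" for b
          unfolding cvec.scale_left_diff_distrib by (simp only: cvec.scale_scale)
        then show ?thesis by (simp only: sum_subtractf sum_distrib_left diff_diff_eq2 diff_add_eq)
      qed
      also have "(\<Sum>b\<in>B. const2 (c b - s * d b) * b) = (\<Sum>b\<in>B - {b0}. const2 (c b - s * d b) * b)"
        using finB b0 nz by (subst sum.remove[of B b0]) (auto simp: s_def const2_def)
      finally show "\<exists>c. g - (\<Sum>b\<in>B - {b0}. const2 (c b) * b) \<in> I" by (intro exI)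
    qed (use finB in simp)
    then have "card B \<le> card (B - {b0})" by (rule min)
    then show False using finB b0 by (metis card_Diff1_less linorder_not_less)
  qed
  then have "quotient_basis I B" using B by (auto simp: quotient_basis_def spans_def)
  then show ?thesis by blast
qed

text \<open>
  Multiplication by \<open>a\<close> induces an isomorphism from \<open>O/(I : a)\<close> onto \<open>J/I\<close>, where
  \<open>J = I + (a)\<close>. On the level of bases: a basis modulo \<open>J\<close>, together with
  \<open>a\<close> times a basis modulo \<open>I : a\<close>, is a basis modulo \<open>I\<close>. This one identity gives both
  the additivity of intersection numbers and the comparison of Tjurina numbers.
\<close>

lemma quotient_dim_colon:
  assumes I: "ideal.subspace I" and prim: "m_primary I"
    and J: "J = {i + z * a | i z. i \<in> I}"
  shows "quotient_dim I = quotient_dim J + quotient_dim {z. z * a \<in> I}"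
proof -
  let ?K = "{z. z * a \<in> I}"
  note Iadd = ideal.subspace_add[OF I] and Iscale = ideal.subspace_scale[OF I]
    and I0 = ideal.subspace_0[OF I]
  have JI: "i + z * a \<in> J" if "i \<in> I" for i z
    unfolding J using that by blast
  have IJ: "I \<subseteq> J" using JI[of _ 0] by auto
  have aJ: "z * a \<in> J" for z using JI[OF I0, of z] by simp
  have Jsub: "ideal.subspace J"
  proof (rule ideal.subspaceI)
    show "0 \<in> J" using IJ I0 by blast
  next
    fix u v assume "u \<in> J" "v \<in> J"
    then obtain i z i' z' where uv: "u = i + z * a" "v = i' + z' * a" "i \<in> I" "i' \<in> I"
      unfolding J by blast
    have "u + v = (i + i') + (z + z') * a" unfolding uv distrib_right by (simp only: ac_simps)
    then show "u + v \<in> J" using JI[OF Iadd[OF uv(3,4)]] by (simp only:)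
  next
    fix c u assume "u \<in> J"
    then obtain i z where u: "u = i + z * a" "i \<in> I" unfolding J by blast
    have "c * u = c * i + (c * z) * a" unfolding u by (simp only: distrib_left mult.assoc)
    then show "c * u \<in> J" using JI[OF Iscale[OF u(2)]] by (simp only:)
  qed
  have Ksub: "ideal.subspace ?K"
  proof (rule ideal.subspaceI)
    show "0 \<in> ?K" using I0 by simp
  qed (simp_all only: mem_Collect_eq distrib_right mult.assoc Iadd Iscale)
  have "m_primary J" using prim IJ by (auto simp: m_primary_def)
  then obtain B where B: "quotient_basis J B" using quotient_basis_exists Jsub by blast
  have "m_primary ?K" using prim Iscale[of _ a] unfolding m_primary_def mem_Collect_eq
    by (metis mult.commute)
  then obtain E where E: "quotient_basis ?K E" using quotient_basis_exists Ksub by blast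
  have fin: "finite B" "finite E" using B E by (auto simp: quotient_basis_def)
  have indB: "\<And>c b. (\<Sum>b\<in>B. const2 (c b) * b) \<in> J \<Longrightarrow> b \<in> B \<Longrightarrow> c b = 0"
    and indE: "\<And>c b. (\<Sum>b\<in>E. const2 (c b) * b) * a \<in> I \<Longrightarrow> b \<in> E \<Longrightarrow> c b = 0"
    using B E by (auto simp: quotient_basis_def)
  have spanB: "\<exists>c. g - (\<Sum>b\<in>B. const2 (c b) * b) \<in> J" for g
    using B unfolding quotient_basis_def by blast
  have spanE: "\<exists>c. (g - (\<Sum>b\<in>E. const2 (c b) * b)) * a \<in> I" for g
    using E unfolding quotient_basis_def mem_Collect_eq by blast
  have inj: "inj_on (\<lambda>z. z * a) E"
  proof (rule inj_onI, rule ccontr)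
    fix u v assume uv: "u \<in> E" "v \<in> E" "u * a = v * a" "u \<noteq> v"
    let ?d = "\<lambda>b. if b = u then 1 else if b = v then -1 else (0::complex)"
    have "(\<Sum>b\<in>E. const2 (?d b) * b) = (\<Sum>b\<in>{u,v}. const2 (?d b) * b)"
      by (rule sum.mono_neutral_right) (use fin uv in \<open>auto simp: const2_0\<close>)
    also have "\<dots> = u - v" using uv by simp
    finally have "(\<Sum>b\<in>E. const2 (?d b) * b) * a \<in> I" using uv I0 by (simp add: left_diff_distrib)
    then show False using indE[of ?d u] uv by simp
  qed
  have disj: "B \<inter> (\<lambda>z. z * a) ` E = {}"
  proof (rule ccontr)
    assume "B \<inter> (\<lambda>z. z * a) ` E \<noteq> {}"
    then obtain e where e: "e * a \<in> B" by blast
    have "(\<Sum>b\<in>B. const2 (if b = e * a then 1 else 0) * b) = (\<Sum>b\<in>B. if b = e * a then e * a else 0)"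
      by (rule sum.cong) simp_all
    also have "\<dots> = e * a" using fin e by simp
    finally show False using indB[of "\<lambda>b. if b = e * a then 1 else 0" "e * a"] e aJ by simp
  qed
  have sum_union: "(\<Sum>b\<in>B \<union> (\<lambda>z. z * a) ` E. const2 (c b) * b)
      = (\<Sum>b\<in>B. const2 (c b) * b) + (\<Sum>b\<in>E. const2 (c (b * a)) * b) * a" for c
    using fin disj
    by (simp only: sum.union_disjoint finite_imageI sum.reindex[OF inj] o_def sum_distrib_right mult.assoc)
  have "quotient_basis I (B \<union> (\<lambda>z. z * a) ` E)"
    unfolding quotient_basis_def
  proof (intro conjI allI impI ballI)
    fix g
    obtain c where c: "g - (\<Sum>b\<in>B. const2 (c b) * b) \<in> J" using spanB by blast
    then obtain i z where iz: "g - (\<Sum>b\<in>B. const2 (c b) * b) = i + z * a" "i \<in> I"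
      unfolding J by blast
    obtain d where d: "(z - (\<Sum>b\<in>E. const2 (d b) * b)) * a \<in> I" using spanE by blast
    let ?c = "\<lambda>b. if b \<in> B then c b else d (the_inv_into E (\<lambda>z. z * a) b)"
    have "(\<Sum>b\<in>E. const2 (?c (b * a)) * b) = (\<Sum>b\<in>E. const2 (d b) * b)"
      using disj by (intro sum.cong) (auto simp: the_inv_into_f_f[OF inj])
    then have "g - (\<Sum>b\<in>B \<union> (\<lambda>z. z * a) ` E. const2 (?c b) * b) 
        = i + (z - (\<Sum>b\<in>E. const2 (d b) * b)) * a"
      using iz(1) unfolding sum_union left_diff_distrib by (simp only: diff_diff_eq[symmetric]) simp
    also have "\<dots> \<in> I" using iz(2) d by (rule Iadd)
    finally show "\<exists>c. g - (\<Sum>b\<in>B \<union> (\<lambda>z. z * a) ` E. const2 (c b) * b) \<in> I" by (intro exI)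
  next
    fix c b assume "(\<Sum>b\<in>B \<union> (\<lambda>z. z * a) ` E. const2 (c b) * b) \<in> I" 
      and b: "b \<in> B \<union> (\<lambda>z. z * a) ` E"
    then have s: "(\<Sum>b\<in>B. const2 (c b) * b) + (\<Sum>b\<in>E. const2 (c (b * a)) * b) * a \<in> I"
      by (simp add: sum_union)
    have "(\<Sum>b\<in>B. const2 (c b) * b) \<in> J"
      using ideal.subspace_diff[OF Jsub subsetD[OF IJ s] aJ[of "\<Sum>b\<in>E. const2 (c (b * a)) * b"]] by simp
    then have c0: "\<And>b. b \<in> B \<Longrightarrow> c b = 0" by (rule indB)
    then have "(\<Sum>b\<in>E. const2 (c (b * a)) * b) * a \<in> I" using s by simp
    then have "\<And>b. b \<in> E \<Longrightarrow> c (b * a) = 0" by (rule indE)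
    then show "c b = 0" using b c0 by auto
  qed (use fin in auto)
  then have "quotient_dim I = card (B \<union> (\<lambda>z. z * a) ` E)" using I quotient_dim_eq_card by blast
  also have "\<dots> = card B + card E" using fin disj by (simp add: card_Un_disjoint card_image inj)
  also have "\<dots> = quotient_dim J + quotient_dim ?K"
    using quotient_dim_eq_card Jsub Ksub B E by simp
  finally show ?thesis .
qed

section \<open>Convergent series\<close>

text \<open>
  The sum is \<open>S\<^sup>j\<close> times the geometric sum of \<open>(B/S)\<^sup>m\<close> for \<open>1 \<le> m \<le> j\<close>, which is at
  most twice its first term.
\<close>

lemma finite_geometric_bound:
  fixes B S :: real
  assumes "0 \<le> B" "2 * B \<le> S"
  shows "S * (\<Sum>b<j. S ^ b * B ^ (j - b)) \<le> 2 * B * S ^ j"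
proof (induction j)
  case (Suc j)
  let ?T = "\<lambda>j. \<Sum>b<j. S ^ b * B ^ (j - b)"
  have "?T (Suc j) = (\<Sum>b<j. S ^ b * B ^ (j - b) * B) + S ^ j * B"
    by (simp add: Suc_diff_le ac_simps)
  then have "?T (Suc j) = ?T j * B + S ^ j * B" by (simp only: sum_distrib_right)
  then have "S * ?T (Suc j) = B * (S * ?T j) + B * S * S ^ j" by (simp add: algebra_simps)
  also have "\<dots> \<le> B * (2 * B * S ^ j) + B * S * S ^ j"
    using Suc assms by (intro add_mono mult_left_mono) auto
  also have "\<dots> = (B * S ^ j) * (2 * B + S)" by (simp add: algebra_simps)
  also have "\<dots> \<le> (B * S ^ j) * (S + S)" using assms by (intro mult_left_mono) auto
  finally show ?case by (simp add: algebra_simps)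
qed (use assms in simp)

text \<open>
  A single constant controls both the radius of convergence and the size of the series, which keeps
  the estimates for products and quotients short.
\<close>

definition geometric_bound :: "real \<Rightarrow> series2 \<Rightarrow> bool" where
  "geometric_bound B F \<longleftrightarrow> 1 \<le> B \<and> (\<forall>i j. norm (F $ j $ i) \<le> B ^ (i + j + 1))"

lemma geometric_bound_mono:
  assumes "geometric_bound B F" "B \<le> C"
  shows "geometric_bound C F"
  using assms unfolding geometric_bound_def by (meson order_trans power_mono zero_le_one)

text \<open>
  The terms of a series that is summable at \<open>x = y = e/2\<close> are bounded, which bounds the
  coefficients geometrically; conversely, for \<open>|x|, |y| < 1/(2B)\<close> the series is dominated by a
  multiple of the double geometric series with ratio \<open>1/2\<close>.
\<close>

lemma convergent_series2_iff: "F \<in> convergent_series2 \<longleftrightarrow> (\<exists>B. geometric_bound B F)"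
proof
  assume "F \<in> convergent_series2"
  then obtain e where e: "e > 0" and sm: "\<And>x y. norm x < e \<Longrightarrow> norm y < e \<Longrightarrow>
           (\<lambda>(i, j). F $ j $ i * x ^ i * y ^ j) summable_on UNIV"
    unfolding convergent_series2_def by blast
  let ?x = "complex_of_real (e / 2)"
  let ?t = "\<lambda>p. norm (case p of (i, j) \<Rightarrow> F $ j $ i * ?x ^ i * ?x ^ j)"
  have "norm ?x < e" using e by (simp only: norm_of_real)
  from sm[OF this this] have sm': "?t summable_on UNIV"
    by (simp only: summable_on_iff_abs_summable_on_complex)
  define M where "M = infsum ?t UNIV"
  have M: "norm (F $ j $ i) * (e / 2) ^ (i + j) \<le> M" for i j
  proof -
    have "sum ?t {(i, j)} \<le> M" unfolding M_def by (rule finite_sum_le_infsum[OF sm']) auto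
    moreover have "sum ?t {(i, j)} = norm (F $ j $ i) * (e / 2) ^ (i + j)"
      using e by (simp add: norm_mult norm_power power_add norm_divide)
    ultimately show ?thesis by simp
  qed
  define B where "B = max 1 (max M (2 / e))"
  have "norm (F $ j $ i) \<le> B ^ (i + j + 1)" for i j
  proof -
    have "norm (F $ j $ i) = norm (F $ j $ i) * (e / 2) ^ (i + j) * (2 / e) ^ (i + j)"
      using e by (simp add: field_simps)
    also have "\<dots> \<le> B * B ^ (i + j)"
      by (intro mult_mono power_mono order_trans[OF M]) (use e in \<open>auto simp: B_def\<close>)
    finally show ?thesis by simp
  qed
  then show "\<exists>B. geometric_bound B F" unfolding geometric_bound_def
    by (intro exI[of _ B]) (auto simp: B_def)
next
  assume "\<exists>B. geometric_bound B F"
  then obtain B where B: "1 \<le> B" and bd: "\<And>i j. norm (F $ j $ i) \<le> B ^ (i + j + 1)"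
    unfolding geometric_bound_def by blast
  have geo: "(\<lambda>i. (1/2::real) ^ i) summable_on UNIV"
    by (rule summable_on_UNIV_nonneg_real_iff[THEN iffD2]) (auto intro: summable_geometric)
  have "(\<lambda>(i,j). (1/2::real) ^ i * (1/2) ^ j) summable_on UNIV \<times> UNIV"
  proof (rule summable_on_SigmaI)
    show "((\<lambda>j. case (i, j) of (i, j) \<Rightarrow> (1/2::real) ^ i * (1/2) ^ j) has_sum (1/2) ^ i * infsum (\<lambda>j. (1/2) ^ j) UNIV) UNIV" for i
      using has_sum_cmult_right[OF has_sum_infsum[OF geo]] by simp
    show "(\<lambda>i. (1/2::real) ^ i * infsum (\<lambda>j. (1/2) ^ j) UNIV) summable_on UNIV"
      by (rule summable_on_cmult_left[OF geo])
  qed auto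
  then have prod: "(\<lambda>p. B * (case p of (i, j) \<Rightarrow> (1/2::real) ^ i * (1/2) ^ j)) summable_on UNIV"
    by (intro summable_on_cmult_right) simp
  have "(\<lambda>(i, j). F $ j $ i * x ^ i * y ^ j) summable_on UNIV"
    if x: "norm x < 1 / (2 * B)" and y: "norm y < 1 / (2 * B)" for x y
  proof -
    have "norm (F $ j $ i * x ^ i * y ^ j) \<le> B * ((1/2) ^ i * (1/2) ^ j)" for i j
    proof -
      have "norm (F $ j $ i * x ^ i * y ^ j) = norm (F $ j $ i) * norm x ^ i * norm y ^ j"
        by (simp add: norm_mult norm_power)
      also have "\<dots> \<le> B ^ (i + j + 1) * (1 / (2 * B)) ^ i * (1 / (2 * B)) ^ j"
        using x y B by (intro mult_mono power_mono bd) auto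
      also have "\<dots> = B * ((1/2) ^ i * (1/2) ^ j)"
        using B by (simp add: power_add power_mult_distrib power_divide)
      finally show ?thesis .
    qed
    then have "(\<lambda>p. norm (case p of (i, j) \<Rightarrow> F $ j $ i * x ^ i * y ^ j)) summable_on UNIV"
      by (intro summable_on_comparison_test[OF prod]) (auto split: prod.splits)
    then show ?thesis by (simp only: summable_on_iff_abs_summable_on_complex)
  qed
  then show "F \<in> convergent_series2"
    unfolding convergent_series2_def using B by (auto intro!: exI[of _ "1 / (2 * B)"])
qed

lemma geometric_bound_common:
  assumes "F \<in> convergent_series2" "G \<in> convergent_series2"
  obtains B where "geometric_bound B F" "geometric_bound B G"
proof -
  obtain B C where BC: "geometric_bound B F" "geometric_bound C G"
    using assms unfolding convergent_series2_iff by blast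
  show thesis
    by (rule that[OF geometric_bound_mono[OF BC(1) max.cobounded1]
          geometric_bound_mono[OF BC(2) max.cobounded2]])
qed

lemma convergent_series2_diff:
  assumes "F \<in> convergent_series2" "G \<in> convergent_series2"
  shows "F - G \<in> convergent_series2"
proof -
  obtain B where B: "geometric_bound B F" "geometric_bound B G"
    using assms by (rule geometric_bound_common)
  have "norm ((F - G) $ j $ i) \<le> (2 * B) ^ (i + j + 1)" for i j
  proof -
    have "norm ((F - G) $ j $ i) \<le> norm (F $ j $ i) + norm (G $ j $ i)"
      by (simp add: norm_triangle_ineq4)
    also have "\<dots> \<le> 2 * B ^ (i + j + 1)"
      using B unfolding geometric_bound_def by (smt (verit))
    also have "\<dots> \<le> 2 ^ (i + j + 1) * B ^ (i + j + 1)"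
      using B unfolding geometric_bound_def by (intro mult_right_mono) auto
    finally show ?thesis by (simp only: power_mult_distrib)
  qed
  then show ?thesis using B unfolding convergent_series2_iff geometric_bound_def
    by (intro exI[of _ "2 * B"]) auto
qed

lemma convergent_series2_mult:
  assumes "F \<in> convergent_series2" "G \<in> convergent_series2"
  shows "F * G \<in> convergent_series2"
proof -
  obtain B where B: "geometric_bound B F" "geometric_bound B G"
    using assms by (rule geometric_bound_common)
  then have B1: "1 \<le> B" by (simp add: geometric_bound_def)
  have "norm ((F * G) $ j $ i) \<le> (2 * B\<^sup>2) ^ (i + j + 1)" for i j
  proof -
    have pt: "norm (F $ b $ a * G $ (j - b) $ (i - a)) \<le> B ^ (i + j + 2)" if "b \<le> j" "a \<le> i" for a b
    proof -
      have "norm (F $ b $ a * G $ (j - b) $ (i - a)) \<le> B ^ (a + b + 1) * B ^ (i - a + (j - b) + 1)"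
        unfolding norm_mult using B unfolding geometric_bound_def by (intro mult_mono) auto
      also have "\<dots> = B ^ (i + j + 2)"
        unfolding power_add[symmetric] using that by simp
      finally show ?thesis .
    qed
    have "norm ((F * G) $ j $ i) \<le> (\<Sum>b\<le>j. \<Sum>a\<le>i. norm (F $ b $ a * G $ (j - b) $ (i - a)))"
      unfolding coeff_mult by (intro sum_norm_le order_refl)
    also have "\<dots> \<le> (\<Sum>b\<le>j. \<Sum>a\<le>i. B ^ (i + j + 2))"
      by (intro sum_mono pt) auto
    also have "\<dots> = (real (Suc i) * real (Suc j)) * B ^ (i + j + 2)" by simp
    also have "\<dots> \<le> 2 ^ (i + j + 1) * B ^ (2 * (i + j + 1))"
    proof (intro mult_mono)
      have "real (Suc i) \<le> 2 ^ i" "real (Suc j) \<le> 2 ^ j"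
        using Suc_leI[OF less_exp[of i]] Suc_leI[OF less_exp[of j]] 
        by (metis of_nat_le_iff of_nat_numeral of_nat_power)+
      then have "real (Suc i) * real (Suc j) \<le> 2 ^ i * 2 ^ j" by (intro mult_mono) auto
      also have "\<dots> \<le> 2 ^ (i + j + 1)" by (simp add: power_add)
      finally show "real (Suc i) * real (Suc j) \<le> 2 ^ (i + j + 1)" .
      show "B ^ (i + j + 2) \<le> B ^ (2 * (i + j + 1))" using B1 by (intro power_increasing) auto
    qed (use B1 in auto)
    also have "\<dots> = (2 * B\<^sup>2) ^ (i + j + 1)" by (simp only: power_mult_distrib power_mult)
    finally show ?thesis .
  qed
  moreover have "1 \<le> 2 * B\<^sup>2" using one_le_power[OF B1, of 2] by linarith
  ultimately show ?thesis unfolding convergent_series2_iff geometric_bound_def by blast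
qed

lemma one_convergent: "1 \<in> convergent_series2" and var_x_convergent: "var_x \<in> convergent_series2"
proof -
  have "geometric_bound 1 1" "geometric_bound 1 var_x"
    by (auto simp: geometric_bound_def var_x_def fps_X_nth fps_one_nth)
  then show "1 \<in> convergent_series2" "var_x \<in> convergent_series2"
    unfolding convergent_series2_iff by blast+
qed

lemma convergent_series2_cancel_var_x:
  assumes "var_x * F \<in> convergent_series2"
  shows "F \<in> convergent_series2"
proof -
  obtain B where B: "geometric_bound B (var_x * F)" using assms convergent_series2_iff by blast
  then have B1: "1 \<le> B" by (simp add: geometric_bound_def)
  have "norm (F $ j $ i) \<le> (B\<^sup>2) ^ (i + j + 1)" for i j
  proof -
    have "norm (F $ j $ i) = norm ((var_x * F) $ j $ (i + 1))"
      using coeff_var_x_power[of 1 F j "i + 1"] by simp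
    also have "\<dots> \<le> B ^ (i + 1 + j + 1)" using B unfolding geometric_bound_def by blast
    also have "\<dots> \<le> B ^ (2 * (i + j + 1))" using B1 by (intro power_increasing) auto
    finally show ?thesis by (simp only: power_mult)
  qed
  then show ?thesis unfolding convergent_series2_iff geometric_bound_def
    using one_le_power[OF B1, of 2] by blast
qed

section \<open>Weierstrass division\<close>

text \<open>
  The coefficient of \<open>x\<^sup>i y\<^sup>j\<close> in the quotient of \<open>G\<close> by \<open>P\<close>, where \<open>P(0,y)\<close> has order
  \<open>d\<close>. The equation is obtained by comparing the coefficients of
  \<open>x\<^sup>i y\<^sup>j\<^sup>+\<^sup>d\<close> in \<open>G\<close> and in \<open>q P\<close>, and solving for the only term that contains the
  unknown coefficient. The recursion ends because all other terms have
  a smaller weight if \<open>x\<close> is given the weight \<open>d + 1\<close> and \<open>y\<close> the weight 1.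
\<close>

function division_coeff :: "series2 \<Rightarrow> series2 \<Rightarrow> nat \<Rightarrow> nat \<Rightarrow> nat \<Rightarrow> complex" where
  "division_coeff P G d i j =
     (G $ (j + d) $ i
      - (\<Sum>b<j. division_coeff P G d i b * P $ (j + d - b) $ 0)
      - (\<Sum>a<i. \<Sum>b\<le>j + d. division_coeff P G d a b * P $ (j + d - b) $ (i - a))) / P $ d $ 0"
  by pat_completeness auto
termination
proof (relation "Wellfounded.measure (\<lambda>(P, G, d, i, j). Suc d * i + j)", goal_cases)
  case (3 P G d i j a b)
  \<comment> \<open>lowering the exponent of \<open>x\<close> gains \<open>d + 1\<close>, raising that of \<open>y\<close> loses at most \<open>d\<close>\<close>
  then have "Suc d * Suc a \<le> Suc d * i" by (intro mult_le_mono2) auto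
  then show ?case using 3 by auto
qed auto

declare division_coeff.simps [simp del]

lemma division_coeff_induct [case_names step]:
  fixes d i j :: nat
  assumes "\<And>i j. (\<And>b. b < j \<Longrightarrow> T i b) \<Longrightarrow> (\<And>a b. a < i \<Longrightarrow> b \<le> j + d \<Longrightarrow> T a b) \<Longrightarrow> T i j"
  shows "T i j"
proof (induction "Suc d * i + j" arbitrary: i j rule: less_induct)
  case less
  show ?case
  proof (rule assms)
    fix a b assume ab: "a < i" "b \<le> j + d"
    then have "Suc d * Suc a \<le> Suc d * i" by (intro mult_le_mono2) auto
    then show "T a b" using ab by (intro less) auto
  qed (use less in auto)
qed

definition division_quotient :: "series2 \<Rightarrow> series2 \<Rightarrow> nat \<Rightarrow> series2" where
  "division_quotient P G d = Abs_fps (\<lambda>j. Abs_fps (\<lambda>i. division_coeff P G d i j))"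

definition y_order :: "nat \<Rightarrow> series2 \<Rightarrow> bool" where
  "y_order d F \<longleftrightarrow> F $ d $ 0 \<noteq> 0 \<and> (\<forall>j<d. F $ j $ 0 = 0)"

text \<open>
  From degree \<open>d\<close> in \<open>y\<close> onwards \<open>G\<close> and \<open>q P\<close> agree by construction of the quotient, so the
  remainder is a polynomial in \<open>y\<close> of degree less than \<open>d\<close>.
\<close>

lemma weierstrass_division:
  assumes P: "y_order d P" and "d \<le> j"
  shows "(G - division_quotient P G d * P) $ j = 0"
proof -
  let ?q = "division_coeff P G d"
  obtain l where l: "j = l + d" using assms(2) by (metis add.commute le_Suc_ex)
  have "(division_quotient P G d * P) $ (l + d) $ i = G $ (l + d) $ i" for i
  proof -
    let ?h = "\<lambda>a. \<Sum>b\<le>l + d. ?q a b * P $ (l + d - b) $ (i - a)"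
    have "(division_quotient P G d * P) $ (l + d) $ i = (\<Sum>a\<le>i. ?h a)"
      unfolding coeff_mult by (subst sum.swap) (simp add: division_quotient_def)
    also have "\<dots> = (\<Sum>a<i. ?h a) + ?h i" by (simp flip: lessThan_Suc_atMost)
    also have "?h i = (\<Sum>b\<le>l. ?q i b * P $ (l + d - b) $ 0)"
      using P by (intro sum.mono_neutral_cong_right) (auto simp: y_order_def)
    also have "\<dots> = (\<Sum>b<l. ?q i b * P $ (l + d - b) $ 0) + ?q i l * P $ d $ 0"
      by (simp flip: lessThan_Suc_atMost)
    also have "?q i l * P $ d $ 0 = G $ (l + d) $ i
      - (\<Sum>b<l. ?q i b * P $ (l + d - b) $ 0) - (\<Sum>a<i. ?h a)"
      using P by (subst division_coeff.simps) (simp add: y_order_def)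
    finally show ?thesis by simp
  qed
  then show ?thesis unfolding l by (simp add: fps_eq_iff)
qed

text \<open>
  By induction along the recursion the coefficients of the quotient satisfy
  \<open>|q\<^sub>i\<^sub>j| \<le> K R\<^sup>i S\<^sup>j\<close>. Terms with a lower power of \<open>y\<close> contribute at most a
  multiple of \<open>B/S\<close> of this bound, and terms with a lower power of \<open>x\<close>, where the power of
  \<open>y\<close> may be higher by \<open>d\<close>, at most a multiple of \<open>S\<^sup>d B/R\<close>. Hence \<open>S\<close> is chosen large
  first, and \<open>R\<close> afterwards depending on \<open>S\<close>. Each group of terms then
  takes up a quarter of the bound, and \<open>K\<close> makes the coefficient of \<open>G\<close> take up one half.
\<close>

lemma division_quotient_convergent:
  assumes P: "y_order d P" and conv: "P \<in> convergent_series2" "G \<in> convergent_series2"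
  shows "division_quotient P G d \<in> convergent_series2"
proof -
  let ?q = "division_coeff P G d"
  obtain B where "geometric_bound B P" "geometric_bound B G"
    using conv by (rule geometric_bound_common)
  then have B1: "1 \<le> B" and bP: "\<And>i j. norm (P $ j $ i) \<le> B ^ (i + j + 1)"
    and bG: "\<And>i j. norm (G $ j $ i) \<le> B ^ (i + j + 1)" by (auto simp: geometric_bound_def)
  define u where "u = norm (P $ d $ 0)"
  have u: "u > 0" using P by (simp add: u_def y_order_def)
  define S where "S = max (2 * B) (8 * B ^ (d + 2) / u)"
  define R where "R = max (2 * B) (16 * B\<^sup>2 * S ^ d / u)"
  define K where "K = 2 * B ^ (d + 1) / u"
  have SB: "2 * B \<le> S" and RB: "2 * B \<le> R" by (auto simp: S_def R_def)
  have S1: "1 \<le> S" and R1: "1 \<le> R" using SB RB B1 by auto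
  have "8 * B ^ (d + 2) / u \<le> S" by (simp add: S_def)
  then have Su: "8 * B ^ (d + 2) \<le> S * u" using u by (simp add: field_simps)
  have "16 * B\<^sup>2 * S ^ d / u \<le> R" by (simp add: R_def)
  then have Ru: "16 * B\<^sup>2 * S ^ d \<le> R * u" using u by (simp add: field_simps)
  have K0: "0 \<le> K" using u B1 by (simp add: K_def)
  have Ku: "K * u = 2 * B ^ (d + 1)" using u by (simp add: K_def)
  note geoS = finite_geometric_bound[of B S] and geoR = finite_geometric_bound[of B R]
  have B0: "0 \<le> B" using B1 by simp
  have bound: "norm (?q i j) \<le> K * R ^ i * S ^ j" for i j
  proof (induction i j rule: division_coeff_induct[where d = d])
    case (step i j)
    let ?M = "K * R ^ i * S ^ j"
    let ?s1 = "\<Sum>b<j. ?q i b * P $ (j + d - b) $ 0"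
    let ?s2 = "\<Sum>a<i. \<Sum>b\<le>j + d. ?q a b * P $ (j + d - b) $ (i - a)"
    have g: "norm (G $ (j + d) $ i) \<le> ?M * u / 2"
    proof -
      have "norm (G $ (j + d) $ i) \<le> B ^ (i + (j + d) + 1)" by (rule bG)
      also have "\<dots> = B ^ (d + 1) * (B ^ i * B ^ j)" by (simp add: power_add)
      also have "\<dots> \<le> B ^ (d + 1) * (R ^ i * S ^ j)"
        using SB RB B1 by (intro mult_left_mono mult_mono power_mono) auto
      also have "\<dots> = ?M * u / 2" using Ku by (simp add: field_simps)
      finally show ?thesis .
    qed
    have s1: "norm ?s1 \<le> ?M * u / 4"
    proof -
      have "norm ?s1 \<le> (\<Sum>b<j. K * R ^ i * S ^ b * B ^ (j + d - b + 1))"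
      proof (rule sum_norm_le)
        fix b assume b: "b \<in> {..<j}"
        have "norm (P $ (j + d - b) $ 0) \<le> B ^ (j + d - b + 1)" using bP[of "j + d - b" 0] by simp
        then show "norm (?q i b * P $ (j + d - b) $ 0) \<le> K * R ^ i * S ^ b * B ^ (j + d - b + 1)"
          unfolding norm_mult using b K0 R1 S1 by (intro mult_mono step(1)) auto
      qed
      also have "\<dots> = (\<Sum>b<j. K * R ^ i * B ^ (d + 1) * (S ^ b * B ^ (j - b)))"
        by (rule sum.cong) (auto simp: power_add[symmetric] ac_simps)
      also have "\<dots> = K * R ^ i * B ^ (d + 1) * (\<Sum>b<j. S ^ b * B ^ (j - b))" (is "_ = ?c * ?T")
        by (simp only: sum_distrib_left)
      finally have *: "norm ?s1 \<le> ?c * ?T" .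
      have "S * (?c * ?T) = ?c * (S * ?T)" by simp
      also have "\<dots> \<le> ?c * (2 * B * S ^ j)"
        using geoS[OF B0 SB] K0 R1 B0 by (intro mult_left_mono) auto
      also have "\<dots> = ?M * (8 * B ^ (d + 2)) / 4" by simp
      also have "\<dots> \<le> ?M * (S * u) / 4"
        using Su K0 R1 S1 by (intro divide_right_mono mult_left_mono) auto
      finally have "S * (?c * ?T) \<le> S * (?M * u / 4)" by (simp add: ac_simps)
      then have "?c * ?T \<le> ?M * u / 4" using S1 by simp
      with * show ?thesis by linarith
    qed
    have s2: "norm ?s2 \<le> ?M * u / 4"
    proof -
      let ?n = "j + d"
      let ?U = "\<Sum>a<i. R ^ a * B ^ (i - a)" and ?V = "\<Sum>b\<le>?n. S ^ b * B ^ (?n - b)"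
      have "norm ?s2 \<le> (\<Sum>a<i. \<Sum>b\<le>?n. K * R ^ a * S ^ b * B ^ (i - a + (?n - b) + 1))"
      proof (intro sum_norm_le)
        fix a b assume ab: "a \<in> {..<i}" "b \<in> {..?n}"
        show "norm (?q a b * P $ (?n - b) $ (i - a)) \<le> K * R ^ a * S ^ b * B ^ (i - a + (?n - b) + 1)"
          unfolding norm_mult using ab K0 R1 S1 by (intro mult_mono step(2) bP) auto
      qed
      also have "\<dots> = (\<Sum>a<i. \<Sum>b\<le>?n. (K * B) * ((R ^ a * B ^ (i - a)) * (S ^ b * B ^ (?n - b))))"
        by (intro sum.cong refl) (simp only: power_add power_one_right ac_simps)
      also have "\<dots> = (K * B) * (?U * ?V)"
        by (simp only: sum_distrib_left[symmetric] sum_product)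
      finally have *: "norm ?s2 \<le> (K * B) * (?U * ?V)" .
      have V: "?V \<le> 2 * S ^ ?n"
      proof -
        have "?V = (\<Sum>b<?n. S ^ b * B ^ (?n - b)) + S ^ ?n" by (simp flip: lessThan_Suc_atMost)
        moreover have "S * (\<Sum>b<?n. S ^ b * B ^ (?n - b)) \<le> S * S ^ ?n"
          by (rule order_trans[OF geoS[OF B0 SB] mult_right_mono[OF SB]]) (use S1 in simp)
        then have "(\<Sum>b<?n. S ^ b * B ^ (?n - b)) \<le> S ^ ?n" using S1 by simp
        ultimately show ?thesis by simp
      qed
      have V0: "0 \<le> ?V" using S1 B0 by (intro sum_nonneg) auto
      have "R * ((K * B) * (?U * ?V)) = (K * B) * ((R * ?U) * ?V)" by simp
      also have "\<dots> \<le> (K * B) * ((2 * B * R ^ i) * (2 * S ^ ?n))"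
        by (intro mult_left_mono mult_mono[OF geoR[OF B0 RB] V]) (use V0 K0 B0 R1 in simp_all)
      also have "\<dots> = ?M * (16 * B\<^sup>2 * S ^ d) / 4" by (simp add: power_add power2_eq_square)
      also have "\<dots> \<le> ?M * (R * u) / 4"
        using Ru K0 R1 S1 by (intro divide_right_mono mult_left_mono) auto
      finally have "R * ((K * B) * (?U * ?V)) \<le> R * (?M * u / 4)" by (simp add: ac_simps)
      then have "(K * B) * (?U * ?V) \<le> ?M * u / 4" using R1 by simp
      with * show ?thesis by linarith
    qed
    have "norm (?q i j) = norm (G $ (j + d) $ i - ?s1 - ?s2) / u"
      by (subst division_coeff.simps) (simp only: norm_divide u_def)
    also have "\<dots> \<le> (?M * u) / u"
      using g s1 s2 norm_triangle_ineq4[of "G $ (j + d) $ i - ?s1" ?s2]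
        norm_triangle_ineq4[of "G $ (j + d) $ i" ?s1] u
      by (intro divide_right_mono) linarith+
    also have "\<dots> = ?M" using u by simp
    finally show ?case .
  qed
  define C where "C = max K (max R S)"
  have C: "K \<le> C" "R \<le> C" "S \<le> C" "1 \<le> C" using R1 by (auto simp: C_def)
  have "norm (?q i j) \<le> C ^ (i + j + 1)" for i j
  proof -
    have "norm (?q i j) \<le> C * C ^ i * C ^ j"
      using C K0 R1 S1 by (intro order_trans[OF bound] mult_mono power_mono) auto
    then show ?thesis by (simp add: power_add)
  qed
  then show ?thesis unfolding convergent_series2_iff geometric_bound_def
    using C(4) by (auto simp: division_quotient_def)
qed

section \<open>Relatively prime series generate an m-primary ideal\<close>

text \<open>
  Division by a series of order 0 leaves no remainder.
\<close>

lemma unit_of_value0: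
  assumes "F $ 0 $ 0 \<noteq> 0"
  shows "\<exists>G. G * F = (1 :: series2)"
proof -
  have "y_order 0 F" using assms by (simp add: y_order_def)
  then have "(1 - division_quotient F 1 0 * F) $ j = 0" for j
    by (rule weierstrass_division) simp
  then have "1 - division_quotient F 1 0 * F = 0" by (simp add: fps_eq_iff)
  then have "division_quotient F 1 0 * F = 1" by (simp only: right_minus_eq)
  then show ?thesis by blast
qed

lemma var_x_not_unit: "var_x * F \<noteq> 1"
proof
  assume "var_x * F = 1"
  then have "(var_x * F) $ 0 $ 0 = 1" by simp
  then show False by (simp add: var_x_def)
qed

lemma var_x_dvd_iff: "var_x dvd F \<longleftrightarrow> (\<forall>j. F $ j $ 0 = 0)"
  using var_x_power_dvd_iff[of 1 F] by (simp only: power_one_right less_one simp_thms)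

lemma y_order_exists:
  assumes "\<not> var_x dvd F"
  obtains d where "y_order d F"
proof -
  obtain j where j: "F $ j $ 0 \<noteq> 0" using assms unfolding var_x_dvd_iff by blast
  have "y_order (LEAST j. F $ j $ 0 \<noteq> 0) F"
    unfolding y_order_def using LeastI[of "\<lambda>j. F $ j $ 0 \<noteq> 0", OF j] not_less_Least by blast
  then show thesis by (rule that)
qed

text \<open>
  Modulo \<open>x\<close> the series \<open>W\<close> is \<open>y\<^sup>d\<close> times a unit.
\<close>

lemma var_y_power_in_ideal_var_x:
  assumes "y_order d W"
  shows "\<exists>V B. var_y ^ d = V * W + var_x * B"
proof -
  define U where "U = Abs_fps (\<lambda>j. fps_const (W $ (j + d) $ 0))"
  have "(W - var_y ^ d * U) $ j $ 0 = 0" for j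
    using assms by (auto simp: y_order_def coeff_var_y_power U_def)
  then have "var_x dvd W - var_y ^ d * U" unfolding var_x_dvd_iff by blast
  then obtain A where A: "W - var_y ^ d * U = var_x * A" by (rule dvdE)
  have "U $ 0 $ 0 \<noteq> 0" using assms by (simp add: U_def y_order_def)
  then obtain V where V: "V * U = 1" using unit_of_value0 by blast
  have "W = var_y ^ d * U + var_x * A" using A by (simp only: diff_eq_eq add.commute)
  then have "V * W = var_y ^ d * (V * U) + var_x * (V * A)" by (simp only: distrib_left mult.left_commute)
  then have "V * W + var_x * (- (V * A)) = var_y ^ d" unfolding V
    by (simp only: mult_minus_right mult_1_right add_diff_cancel_right' flip: diff_conv_add_uminus)
  then show ?thesis by (metis (no_types))
qed

text \<open>
  The properties shared by the rings of formal and of convergent power series on which the argument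
  rests. Divisibility has to be witnessed within \<open>A\<close>, as relative primality refers to \<open>A\<close>.
\<close>

locale division_subring =
  fixes A :: "series2 set"
  assumes one: "1 \<in> A" and var_x: "var_x \<in> A"
    and diff: "F \<in> A \<Longrightarrow> G \<in> A \<Longrightarrow> F - G \<in> A"
    and mult: "F \<in> A \<Longrightarrow> G \<in> A \<Longrightarrow> F * G \<in> A"
    and cancel_var_x: "var_x * F \<in> A \<Longrightarrow> F \<in> A"
    and division: "P \<in> A \<Longrightarrow> G \<in> A \<Longrightarrow> y_order d P \<Longrightarrow>
      \<exists>q\<in>A. \<forall>j\<ge>d. (G - q * P) $ j = 0"
begin

lemma zero: "0 \<in> A"
proof -
  have "1 - 1 \<in> A" by (rule diff[OF one one])
  then show ?thesis unfolding diff_self .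
qed

lemma var_x_power: "var_x ^ k \<in> A"
proof (induction k)
  case 0
  show ?case using one by simp
next
  case (Suc k)
  show ?case unfolding power_Suc by (intro mult var_x Suc)
qed

lemma cancel_var_x_power: "var_x ^ k * F \<in> A \<Longrightarrow> F \<in> A"
proof (induction k)
  case (Suc k)
  from Suc.prems have "var_x * (var_x ^ k * F) \<in> A" by (simp only: power_Suc mult.assoc)
  then show ?case by (rule Suc.IH[OF cancel_var_x])
next
  case 0
  then show ?case unfolding power_0 mult_1_left .
qed

lemma split_var_x_power:
  assumes "F \<in> A" "F \<noteq> 0"
  obtains k G where "F = var_x ^ k * G" "G \<in> A" "\<not> var_x dvd G" "\<And>j. G $ j $ 0 = F $ j $ k"
proof -
  have ex: "\<exists>i j. F $ j $ i \<noteq> 0" using assms(2) by (auto simp: fps_eq_iff)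
  define k where "k = (LEAST i. \<exists>j. F $ j $ i \<noteq> 0)"
  obtain j where j: "F $ j $ k \<noteq> 0" unfolding k_def using LeastI_ex[OF ex] by blast
  have "F $ j $ i = 0" if "i < k" for i j
    using not_less_Least[OF that[unfolded k_def]] by blast
  then have "var_x ^ k dvd F" unfolding var_x_power_dvd_iff by blast
  then obtain G where G: "F = var_x ^ k * G" by (rule dvdE)
  have c: "G $ j $ 0 = F $ j $ k" for j
    using coeff_var_x_power[of k G j k] by (simp add: G)
  show thesis
  proof (rule that[OF G])
    show "G \<in> A" using assms(1) unfolding G by (rule cancel_var_x_power)
    show "\<not> var_x dvd G" unfolding var_x_dvd_iff c using j by blast
  qed (rule c)
qed

text \<open>
  The ideal \<open>(P, Q) : x\<^sup>\<infinity>\<close> of \<open>A\<close>, that is, the elements of \<open>A\<close> that lie in the ideal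
  generated by \<open>P\<close> and \<open>Q\<close> once \<open>x\<close> is inverted. Its elements may be divided by \<open>x\<close>
  whenever this is possible in \<open>A\<close>.
\<close>

definition saturation :: "series2 \<Rightarrow> series2 \<Rightarrow> series2 set" where
  "saturation P Q = {F \<in> A. \<exists>k. \<exists>a\<in>A. \<exists>b\<in>A. var_x ^ k * F = a * P + b * Q}"

lemma saturation_mult:
  assumes "F \<in> saturation P Q" "c \<in> A"
  shows "c * F \<in> saturation P Q"
proof -
  obtain k a b where *: "F \<in> A" "a \<in> A" "b \<in> A" "var_x ^ k * F = a * P + b * Q"
    using assms(1) unfolding saturation_def by blast
  have "var_x ^ k * (c * F) = (c * a) * P + (c * b) * Q"
    by (simp only: mult.left_commute[of _ c] *(4) distrib_left mult.assoc)
  moreover have "c * F \<in> A" "c * a \<in> A" "c * b \<in> A" using assms(2) * mult by auto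
  ultimately show ?thesis unfolding saturation_def by blast
qed

lemma saturation_diff:
  assumes "F \<in> saturation P Q" "G \<in> saturation P Q"
  shows "F - G \<in> saturation P Q"
proof -
  obtain k a b where 1: "F \<in> A" "a \<in> A" "b \<in> A" "var_x ^ k * F = a * P + b * Q"
    using assms(1) unfolding saturation_def by blast
  obtain l c d where 2: "G \<in> A" "c \<in> A" "d \<in> A" "var_x ^ l * G = c * P + d * Q"
    using assms(2) unfolding saturation_def by blast
  have "var_x ^ (k + l) * (F - G) = var_x ^ l * (var_x ^ k * F) - var_x ^ k * (var_x ^ l * G)"
    unfolding power_add right_diff_distrib by (simp only: ac_simps)
  also have "\<dots> = (var_x ^ l * a - var_x ^ k * c) * P + (var_x ^ l * b - var_x ^ k * d) * Q"
    unfolding 1 2 by (simp only: distrib_left left_diff_distrib mult.assoc add_diff_add)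
  finally have "var_x ^ (k + l) * (F - G)
      = (var_x ^ l * a - var_x ^ k * c) * P + (var_x ^ l * b - var_x ^ k * d) * Q" .
  moreover have "F - G \<in> A" "var_x ^ l * a - var_x ^ k * c \<in> A" "var_x ^ l * b - var_x ^ k * d \<in> A"
    by (intro diff mult var_x_power 1 2)+
  ultimately show ?thesis unfolding saturation_def by blast
qed

lemma saturation_cancel:
  assumes "var_x ^ l * F \<in> saturation P Q"
  shows "F \<in> saturation P Q"
proof -
  obtain k a b where 1: "var_x ^ l * F \<in> A" "a \<in> A" "b \<in> A" "var_x ^ k * (var_x ^ l * F) = a * P + b * Q"
    using assms(1) unfolding saturation_def by blast
  have "var_x ^ (k + l) * F = a * P + b * Q" using 1(4) by (simp only: power_add mult.assoc)
  moreover have "F \<in> A" using 1(1) by (rule cancel_var_x_power)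
  ultimately show ?thesis unfolding saturation_def using 1(2,3) by blast
qed

text \<open>
  The saturation is principal. Choose \<open>F\<close> in it with \<open>F(0,y)\<close> of least order \<open>d\<close> and divide
  any other element by \<open>F\<close>. If the remainder were non-zero, then, after removal of its powers of
  \<open>x\<close>, it would be an element of the saturation whose order in \<open>y\<close> is
  less than \<open>d\<close>. So \<open>F\<close> is a common divisor of \<open>P\<close> and \<open>Q\<close>, hence a unit, and
  therefore \<open>(P, Q)\<close> contains a power of \<open>x\<close>. As \<open>x\<close> does not divide both of them,
  some \<open>W\<close> among \<open>P\<close> and \<open>Q\<close> is a unit times a power of \<open>y\<close> modulo \<open>x\<close>. That power of
  \<open>y\<close> lies in \<open>(W, x)\<close>, and its \<open>k\<close>-th power in \<open>(W, x\<^sup>k)\<close>, hence in \<open>(P, Q)\<close> for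
  suitable \<open>k\<close>.
\<close>

lemma m_primary_of_relatively_prime:
  assumes PA: "P \<in> A" and QA: "Q \<in> A" and coprime: "relatively_prime_in A P Q"
  shows "m_primary (ideal_generated {P, Q})"
proof -
  let ?I = "ideal_generated {P, Q}" and ?S = "saturation P Q"
  have scale: "c * z \<in> ?I" if "z \<in> ?I" for c z
    by (rule ideal.subspace_scale[OF ideal_subspace that])
  have PI: "P \<in> ?I" and QI: "Q \<in> ?I" unfolding ideal_generated_def by (rule ideal.span_base, simp)+
  obtain W where W: "W \<in> {P, Q}" "\<not> var_x dvd W"
  proof -
    have "\<not> (var_x dvd P \<and> var_x dvd Q)"
    proof
      assume "var_x dvd P \<and> var_x dvd Q"
      then obtain p q where pq: "P = var_x * p" "Q = var_x * q" by (auto elim!: dvdE)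
      then have "p \<in> A" "q \<in> A" using PA QA cancel_var_x by auto
      then have "\<exists>d\<in>A. var_x * d = 1" using coprime var_x pq unfolding relatively_prime_in_def by blast
      then show False using var_x_not_unit by blast
    qed
    then show thesis using that by blast
  qed
  have "var_x ^ 0 * P = 1 * P + 0 * Q" "var_x ^ 0 * Q = 0 * P + 1 * Q" by simp_all
  then have PS: "P \<in> ?S" and QS: "Q \<in> ?S"
    unfolding saturation_def using PA QA one zero by blast+
  obtain w where w: "y_order w W" using y_order_exists[OF W(2)] by blast
  have "W \<in> ?S" using W PS QS by blast
  then have ex: "\<exists>d. \<exists>F\<in>?S. y_order d F" using w by blast
  define d where "d = (LEAST d. \<exists>F\<in>?S. y_order d F)"
  obtain F where F: "F \<in> ?S" "y_order d F" unfolding d_def using LeastI_ex[OF ex] by blast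
  have FA: "F \<in> A" using F(1) by (simp add: saturation_def)
  have divides: "\<exists>q\<in>A. G = F * q" if G: "G \<in> ?S" for G
  proof -
    have GA: "G \<in> A" using G by (simp add: saturation_def)
    obtain q where q: "q \<in> A" "\<And>j. j \<ge> d \<Longrightarrow> (G - q * F) $ j = 0"
      using division[OF FA GA F(2)] by blast
    define R where "R = G - q * F"
    have RS: "R \<in> ?S" unfolding R_def by (intro saturation_diff saturation_mult G F q)
    have "R = 0"
    proof (rule ccontr)
      assume "R \<noteq> 0"
      moreover have "R \<in> A" using RS by (simp add: saturation_def)
      ultimately obtain k T where T: "R = var_x ^ k * T" "\<not> var_x dvd T" "\<And>j. T $ j $ 0 = R $ j $ k"
        using split_var_x_power[of R] by metis
      obtain e where e: "y_order e T" using y_order_exists[OF T(2)] by blast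
      have "T \<in> ?S" using RS T(1) saturation_cancel by blast
      then have "d \<le> e" unfolding d_def using e by (intro Least_le) blast
      then have "R $ e = 0" unfolding R_def by (rule q(2))
      then show False using e T(3)[of e] by (simp add: y_order_def)
    qed
    then have "G = F * q" by (simp only: R_def right_minus_eq mult.commute)
    then show ?thesis using q(1) by blast
  qed
  obtain e where e: "F * e = 1"
    using coprime divides[OF PS] divides[OF QS] FA unfolding relatively_prime_in_def by blast
  obtain k a b where k: "var_x ^ k * F = a * P + b * Q"
    using F(1) unfolding saturation_def by blast
  have "var_x ^ k = var_x ^ k * F * e" by (simp only: mult.assoc e mult_1_right)
  also have "\<dots> = (e * a) * P + (e * b) * Q"
    unfolding k by (simp only: mult.commute[of _ e] distrib_left mult.assoc)
  finally have vxk: "var_x ^ k \<in> ?I" unfolding ideal_generated_2 by blast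
  obtain V B where VB: "var_y ^ w = V * W + var_x * B" using var_y_power_in_ideal_var_x[OF w] by blast
  define D where "D = (\<Sum>i<k. (var_x * B) ^ (k - Suc i) * (var_y ^ w) ^ i)"
  have "(var_y ^ w) ^ k - (var_x * B) ^ k = (var_y ^ w - var_x * B) * D"
    unfolding D_def by (rule power_diff_sumr2)
  also have "var_y ^ w - var_x * B = V * W" unfolding VB by (simp only: add_diff_cancel_right')
  also have "V * W * D = (V * D) * W" by (simp only: ac_simps)
  finally have Z: "(V * D) * W = var_y ^ (w * k) - var_x ^ k * B ^ k"
    by (simp only: power_mult power_mult_distrib)
  have "W \<in> ?I" using W(1) PI QI by blast
  then have "(V * D) * W + B ^ k * var_x ^ k \<in> ?I"
    by (intro ideal.subspace_add[OF ideal_subspace] scale vxk)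
  also have "(V * D) * W + B ^ k * var_x ^ k = var_y ^ (w * k)"
    unfolding Z by (simp only: mult.commute[of "B ^ k"] diff_add_cancel)
  finally have vyk: "var_y ^ (w * k) \<in> ?I" .
  have "var_x ^ (w * k + k) \<in> ?I" "var_y ^ (w * k + k) \<in> ?I"
    using scale[OF vxk, of "var_x ^ (w * k)"] scale[OF vyk, of "var_y ^ k"]
    by (simp_all only: power_add mult.commute[of "var_y ^ k"])
  then show ?thesis unfolding m_primary_def by blast
qed

end

interpretation formal: division_subring UNIV
proof
  fix P G :: series2 and d assume "y_order d P"
  then show "\<exists>q\<in>UNIV. \<forall>j\<ge>d. (G - q * P) $ j = 0" using weierstrass_division by blast
qed auto

interpretation conv: division_subring convergent_series2
proof
  fix P G :: series2 and d 
  assume "P \<in> convergent_series2" "G \<in> convergent_series2" "y_order d P"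
  then show "\<exists>q\<in>convergent_series2. \<forall>j\<ge>d. (G - q * P) $ j = 0"
    using weierstrass_division division_quotient_convergent by blast
qed (fact one_convergent var_x_convergent convergent_series2_diff convergent_series2_mult
      convergent_series2_cancel_var_x)+

section \<open>Intersection multiplicities\<close>

text \<open>
  If \<open>(g, k)\<close> contains \<open>x\<^sup>n\<close> and \<open>y\<^sup>n\<close> and \<open>k a\<close> is a multiple of \<open>g\<close>, then so are
  \<open>x\<^sup>n a\<close> and \<open>y\<^sup>n a\<close>.
\<close>

lemma dvd_of_dvd_mult_m_primary:
  assumes prim: "m_primary (ideal_generated {g, k})" and dvd: "g dvd k * a"
  shows "g dvd a"
proof -
  obtain n where n: "var_x ^ n \<in> ideal_generated {g, k}" "var_y ^ n \<in> ideal_generated {g, k}"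
    using prim unfolding m_primary_def by blast
  have *: "g dvd w * a" if w: "w \<in> ideal_generated {g, k}" for w
  proof -
    obtain p q where pq: "w = p * g + q * k" using w unfolding ideal_generated_2 by blast
    have "w * a = g * (p * a) + q * (k * a)" unfolding pq by algebra
    also have "g dvd \<dots>" by (intro dvd_add dvd_triv_left dvd_mult dvd)
    finally show ?thesis .
  qed
  show ?thesis by (rule dvd_of_dvd_var_x_var_y_multiples[OF *[OF n(1)] *[OF n(2)]])
qed

lemma m_primary_mult:
  assumes "m_primary (ideal_generated {a, c})" "m_primary (ideal_generated {b, c})"
  shows "m_primary (ideal_generated {a * b, c})"
proof -
  have *: "v * w \<in> ideal_generated {a * b, c}"
    if v: "v \<in> ideal_generated {a, c}" and w: "w \<in> ideal_generated {b, c}" for v w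
  proof -
    obtain p q s t where pq: "v = p * a + q * c" "w = s * b + t * c"
      using v w unfolding ideal_generated_2 by blast
    have "v * w = (p * s) * (a * b) + (p * a * t + q * w) * c" unfolding pq by algebra
    then show ?thesis unfolding ideal_generated_2 by blast
  qed
  obtain n m where "var_x ^ n \<in> ideal_generated {a, c}" "var_y ^ n \<in> ideal_generated {a, c}"
    "var_x ^ m \<in> ideal_generated {b, c}" "var_y ^ m \<in> ideal_generated {b, c}"
    using assms unfolding m_primary_def by blast
  then have "var_x ^ (n + m) \<in> ideal_generated {a * b, c}" "var_y ^ (n + m) \<in> ideal_generated {a * b, c}"
    unfolding power_add by (simp_all only: *)
  then show ?thesis unfolding m_primary_def by blast
qed

lemma intersection_multiplicity_commute: "intersection_multiplicity a b = intersection_multiplicity b a"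
  unfolding intersection_multiplicity_def by (simp only: insert_commute)

text \<open>
  In \<open>quotient_dim_colon\<close> with \<open>I = (a b, c)\<close> one has \<open>I + (a) = (a, c)\<close>, and
  \<open>I : a = (b, c)\<close> because \<open>c\<close> is a non-zero-divisor modulo \<open>a\<close>.
\<close>

lemma intersection_multiplicity_mult:
  assumes a: "a \<noteq> 0" and ac: "m_primary (ideal_generated {a, c})" 
    and bc: "m_primary (ideal_generated {b, c})"
  shows "intersection_multiplicity (a * b) c
    = intersection_multiplicity a c + intersection_multiplicity b c"
proof -
  let ?I = "ideal_generated {a * b, c}"
  have J: "ideal_generated {a, c} = {i + z * a | i z. i \<in> ?I}" (is "_ = ?J")
  proof (intro set_eqI iffI)
    fix w assume "w \<in> ideal_generated {a, c}"
    then obtain p q where "w = p * a + q * c" unfolding ideal_generated_2 by blast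
    then have "w = (0 * (a * b) + q * c) + p * a" by simp
    then show "w \<in> ?J" unfolding ideal_generated_2 by blast
  next
    fix w assume "w \<in> ?J"
    then obtain p q z where "w = p * (a * b) + q * c + z * a" unfolding ideal_generated_2 by blast
    then have "w = (p * b + z) * a + q * c" by algebra
    then show "w \<in> ideal_generated {a, c}" unfolding ideal_generated_2 by blast
  qed
  have K: "{z. z * a \<in> ?I} = ideal_generated {b, c}"
  proof (intro set_eqI iffI)
    fix z assume "z \<in> {z. z * a \<in> ?I}"
    then obtain p q where pq: "z * a = p * (a * b) + q * c" unfolding ideal_generated_2 by blast
    have "c * q = z * a - p * (a * b)" unfolding pq by algebra
    also have "\<dots> = a * (z - p * b)" by algebra
    finally have cq: "c * q = a * (z - p * b)" .
    then have "a dvd c * q" by (rule dvdI)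
    then have "a dvd q" by (rule dvd_of_dvd_mult_m_primary[OF ac])
    then obtain q' where q': "q = a * q'" by (rule dvdE)
    have "a * (c * q') = a * (z - p * b)" using cq unfolding q' by (simp only: mult.left_commute)
    then have "c * q' = z - p * b" using a by (simp only: mult_cancel_left simp_thms)
    then have "z = p * b + q' * c" by algebra
    then show "z \<in> ideal_generated {b, c}" unfolding ideal_generated_2 by blast
  next
    fix z assume "z \<in> ideal_generated {b, c}"
    then obtain p q where "z = p * b + q * c" unfolding ideal_generated_2 by blast
    then have "z * a = p * (a * b) + (q * a) * c" by algebra
    then show "z \<in> {z. z * a \<in> ?I}" unfolding ideal_generated_2 by blast
  qed
  show ?thesis unfolding intersection_multiplicity_def
    using quotient_dim_colon[OF ideal_subspace m_primary_mult[OF ac bc] J] unfolding K .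
qed

lemma ideal_generated_unit: "u dvd 1 \<Longrightarrow> ideal_generated {u, c} = UNIV"
proof -
  assume "u dvd 1"
  then obtain v where v: "1 = u * v" by (rule dvdE)
  have "z = (z * v) * u + 0 * c" for z using v by (simp add: mult.assoc mult.commute[of v])
  then show ?thesis unfolding ideal_generated_2 by blast
qed

lemma m_primary_unit: "u dvd 1 \<Longrightarrow> m_primary (ideal_generated {u, c})"
  by (simp only: ideal_generated_unit m_primary_def UNIV_I simp_thms)

lemma intersection_multiplicity_unit: "u dvd 1 \<Longrightarrow> intersection_multiplicity u c = 0"
proof -
  assume u: "u dvd 1"
  have "quotient_basis UNIV {}" by (simp add: quotient_basis_def)
  then have "quotient_dim UNIV = card ({} :: series2 set)"
    by (intro quotient_dim_eq_card ideal.subspace_UNIV)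
  then show ?thesis unfolding intersection_multiplicity_def ideal_generated_unit[OF u] by simp
qed

lemma intersection_multiplicity_prod:
  assumes "finite S" "\<And>i. i \<in> S \<Longrightarrow> g i \<noteq> 0" "\<And>i. i \<in> S \<Longrightarrow> m_primary (ideal_generated {g i, c})"
    "m_primary (ideal_generated {b, c})"
  shows "m_primary (ideal_generated {(\<Prod>i\<in>S. g i) * b, c}) \<and>
    intersection_multiplicity ((\<Prod>i\<in>S. g i) * b) c
      = (\<Sum>i\<in>S. intersection_multiplicity (g i) c) + intersection_multiplicity b c"
  using assms
proof (induction S rule: finite_induct)
  case (insert i S)
  let ?F = "(\<Prod>i\<in>S. g i) * b"
  have IH: "m_primary (ideal_generated {?F, c})"
    "intersection_multiplicity ?F c = (\<Sum>i\<in>S. intersection_multiplicity (g i) c) + intersection_multiplicity b c"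
    using insert by simp_all
  have i: "g i \<noteq> 0" "m_primary (ideal_generated {g i, c})" using insert.prems by simp_all
  have eq: "(\<Prod>i\<in>insert i S. g i) * b = g i * ?F" 
    using prod.insert[OF insert.hyps, of g] by (simp only: mult.assoc)
  show ?case unfolding eq
    using m_primary_mult[OF i(2) IH(1)] intersection_multiplicity_mult[OF i IH(1)] IH(2) insert
    by simp
qed simp

lemma ideal_generated_cong_dvd:
  assumes "g dvd F - F'"
  shows "ideal_generated {g, F} = ideal_generated {g, F'}"
proof -
  have *: "ideal_generated {g, F} \<subseteq> ideal_generated {g, F'}" if dvd: "g dvd F - F'" for F F'
  proof
    fix z assume "z \<in> ideal_generated {g, F}"
    then obtain p q where z: "z = p * g + q * F" unfolding ideal_generated_2 by blast
    obtain k where "F - F' = g * k" using dvd by (rule dvdE)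
    then have F: "F = g * k + F'" by (simp only: diff_eq_eq)
    have "z = (p + q * k) * g + q * F'"  unfolding z F by algebra
    then show "z \<in> ideal_generated {g, F'}" unfolding ideal_generated_2 by blast
  qed
  have "g dvd F' - F" using assms by (metis dvd_minus_iff minus_diff_eq)
  then show ?thesis using * assms by blast
qed

section \<open>Tjurina numbers of a foliation and of an invariant curve\<close>

text \<open>
  If \<open>z q = b q'\<close> modulo \<open>g\<close>, then the hypothesis \<open>q f' = q' f''\<close> modulo \<open>g\<close> turns this
  relation, multiplied by \<open>f'\<close>, into \<open>q' (z f'' - b f') = 0\<close>; now cancel \<open>q'\<close>.
\<close>

lemma colon_subset:
  assumes prim: "m_primary (ideal_generated {g, q'})" and dvd: "g dvd q * f' - q' * f''"
  shows "{z. z * q \<in> ideal_generated {g, q'}} \<subseteq> {z. z * f'' \<in> ideal_generated {g, f'}}"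
proof clarify
  fix z assume "z * q \<in> ideal_generated {g, q'}"
  then obtain p b where zq: "z * q = p * g + b * q'" unfolding ideal_generated_2 by blast
  obtain w where w: "q * f' - q' * f'' = g * w" using dvd by (rule dvdE)
  have "q' * (z * f'' - b * f') = (z * q - b * q') * f' - z * (q * f' - q' * f'')"
    by algebra
  also have "\<dots> = g * (p * f' - z * w)"
    unfolding zq w by algebra
  finally have "g dvd q' * (z * f'' - b * f')" by (rule dvdI)
  then have "g dvd z * f'' - b * f'" by (rule dvd_of_dvd_mult_m_primary[OF prim])
  then obtain v where "z * f'' - b * f' = g * v" by (rule dvdE)
  then have "z * f'' = v * g + b * f'" by (simp only: diff_eq_eq mult.commute)
  then show "z * f'' \<in> ideal_generated {g, f'}" unfolding ideal_generated_2 by blast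
qed

text \<open>
  Both \<open>(g, q') : q\<close> and \<open>(g, f') : f''\<close> measure how far the quotient shrinks when the third
  generator is added, and by proportionality they coincide.
\<close>

lemma quotient_dim_exchange:
  assumes prim: "m_primary (ideal_generated {g, q'})" "m_primary (ideal_generated {g, f'})" 
    and dvd: "g dvd q * f' - q' * f''"
  shows "intersection_multiplicity g q' + quotient_dim (ideal_generated {g, f', f''})
    = intersection_multiplicity g f' + quotient_dim (ideal_generated {g, q', q})"
proof -
  have J: "ideal_generated {g, a, b} = {i + z * b | i z. i \<in> ideal_generated {g, a}}" for a b
    unfolding ideal_generated_3 ideal_generated_2 by blast
  have "f'' * q' - f' * q = - (q * f' - q' * f'')" by (simp only: minus_diff_eq mult.commute)
  then have "g dvd f'' * q' - f' * q" using dvd by (simp only: dvd_minus_iff)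
  then have dvd': "g dvd f'' * q' - f' * q" .
  then have "{z. z * q \<in> ideal_generated {g, q'}} = {z. z * f'' \<in> ideal_generated {g, f'}}"
    by (intro equalityI colon_subset[OF prim(1) dvd] colon_subset[OF prim(2) dvd'])
  then show ?thesis
    using quotient_dim_colon[OF ideal_subspace prim(1) J[of q' q]]
      quotient_dim_colon[OF ideal_subspace prim(2) J[of f' f'']]
    unfolding intersection_multiplicity_def by simp
qed

lemma deriv_y_mult: "deriv_y (F * G) = deriv_y F * G + F * deriv_y G"
  unfolding deriv_y_def fps_deriv_mult by (rule add.commute)

lemma deriv_x_mult: "deriv_x (F * G) = deriv_x F * G + F * deriv_x G"
proof (rule fps_ext)
  fix n
  have "deriv_x (F * G) $ n = (\<Sum>i=0..n. fps_deriv (F $ i * G $ (n - i)))"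
    by (simp add: deriv_x_def fps_mult_nth fps_deriv_sum)
  also have "\<dots> = (\<Sum>i=0..n. fps_deriv (F $ i) * G $ (n - i)) + (\<Sum>i=0..n. F $ i * fps_deriv (G $ (n - i)))"
    by (simp only: fps_deriv_mult sum.distrib) (rule add.commute)
  also have "\<dots> = (deriv_x F * G + F * deriv_x G) $ n"
    by (simp add: deriv_x_def fps_mult_nth)
  finally show "deriv_x (F * G) $ n = (deriv_x F * G + F * deriv_x G) $ n" .
qed

text \<open>
  The derivation \<open>\<partial>\<^sub>x + t \<partial>\<^sub>y\<close>. The parameter \<open>t\<close> replaces a generic linear change of
  coordinates: \<open>\<partial>\<^sub>x\<close> alone could annihilate a component such as \<open>y = 0\<close>.
\<close>

definition directional :: "complex \<Rightarrow> series2 \<Rightarrow> series2" where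
  "directional t F = deriv_x F + const2 t * deriv_y F"

lemma directional_mult: "directional t (F * G) = directional t F * G + F * directional t G"
  unfolding directional_def deriv_x_mult deriv_y_mult by algebra

lemma coeff_mult_low_weight:
  assumes "\<And>i j. i + j < n \<Longrightarrow> g $ j $ i = 0" "i + j < n"
  shows "(g * h) $ j $ i = (0 :: complex)"
  unfolding coeff_mult by (intro sum.neutral ballI) (use assms in simp)

text \<open>
  One of the derivatives of \<open>g\<close> has a term of degree one less than the lowest degree that occurs
  in \<open>g\<close>, whereas multiples of \<open>g\<close> have no such term. That lowest degree is positive because
  \<open>g\<close> is not a unit.
\<close>

lemma irreducible_not_dvd_derivs:
  assumes "irreducible g"
  shows "\<not> (g dvd deriv_x g \<and> g dvd deriv_y g)"
proof
  assume dvd: "g dvd deriv_x g \<and> g dvd deriv_y g"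
  have g: "g \<noteq> 0" "\<not> g dvd 1" using assms by (auto simp: irreducible_def)
  have ex: "\<exists>n. \<exists>i j. i + j = n \<and> g $ j $ i \<noteq> 0" using g(1) by (auto simp: fps_eq_iff)
  define n where "n = (LEAST n. \<exists>i j. i + j = n \<and> g $ j $ i \<noteq> 0)"
  obtain i j where ij: "i + j = n" "g $ j $ i \<noteq> 0" unfolding n_def using LeastI_ex[OF ex] by blast
  have low: "g $ b $ a = 0" if "a + b < n" for a b
    using not_less_Least[OF that[unfolded n_def]] by blast
  have low': "F $ b $ a = 0" if "g dvd F" "a + b < n" for F a b
  proof -
    from that(1) obtain h where h: "F = g * h" by (rule dvdE)
    show ?thesis unfolding h using low that(2) by (rule coeff_mult_low_weight)
  qed
  show False
  proof (cases i)
    case (Suc i')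
    have "deriv_x g $ j $ i' = 0" using dvd ij Suc by (intro low') auto
    then have "of_nat (Suc i') * g $ j $ Suc i' = 0" by (simp add: deriv_x_def)
    then show False using ij Suc by (simp del: of_nat_Suc)
  next
    case i0: 0
    show False
    proof (cases j)
      case (Suc j')
      have "deriv_y g $ j' $ i = 0" using dvd ij Suc by (intro low') auto
      then have "(of_nat (Suc j') * g $ Suc j') $ i = 0" by (simp add: deriv_y_def)
      then have "of_nat (Suc j') * g $ Suc j' $ i = 0"
        by (simp only: fps_of_nat[symmetric] fps_mult_left_const_nth)
      then show False using ij Suc by (simp del: of_nat_Suc)
    next
      case 0
      then have "g $ 0 $ 0 \<noteq> 0" using ij i0 by simp
      then obtain h where "h * g = 1" using unit_of_value0 by blast
      then have "1 = g * h" by (simp only: mult.commute)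
      then have "g dvd 1" by (rule dvdI)
      then show False using g(2) by blast
    qed
  qed
qed

text \<open>
  Two different bad directions would span all directions, so that \<open>g\<close> would divide both of its
  derivatives. Hence there is at most one.
\<close>

lemma finite_bad_directions:
  assumes "irreducible g"
  shows "finite {t. g dvd directional t g}"
proof -
  have "s = t" if st: "g dvd directional s g" "g dvd directional t g" for s t
  proof (rule ccontr)
    assume ne: "s \<noteq> t"
    have "directional s g - directional t g = const2 (s - t) * deriv_y g"
      unfolding directional_def cvec.scale_left_diff_distrib by (simp only: add_diff_cancel_left)
    then have *: "g dvd const2 (s - t) * deriv_y g" using dvd_diff[OF st] by simp
    have inv: "const2 (1 / (s - t)) * (const2 (s - t) * deriv_y g) = deriv_y g"
      using ne by (simp only: cvec.scale_scale) simp
    have y: "g dvd deriv_y g" using dvd_mult[OF *, of "const2 (1 / (s - t))"] unfolding inv .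
    have "directional s g - const2 s * deriv_y g = deriv_x g"
      unfolding directional_def by (simp only: add_diff_cancel_right')
    then have "g dvd deriv_x g" using dvd_diff[OF st(1) dvd_mult[OF y]] by metis
    then show False using irreducible_not_dvd_derivs[OF assms] y by blast
  qed
  then have "{t. g dvd directional t g} \<subseteq> {SOME t. g dvd directional t g}"
    by (metis (mono_tags, lifting) mem_Collect_eq singleton_iff someI subsetI)
  then show ?thesis by (rule finite_subset) simp
qed

text \<open>
  A common divisor of \<open>g\<close> and \<open>h\<close> that is not a unit is associated to the irreducible
  \<open>g\<close>, and so \<open>g\<close> would divide \<open>h\<close>.
\<close>

lemma m_primary_irreducible:
  assumes g: "irreducible g" and h: "\<not> g dvd h"
  shows "m_primary (ideal_generated {g, h})"
proof (rule formal.m_primary_of_relatively_prime)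
  show "relatively_prime_in UNIV g h"
    unfolding relatively_prime_in_def
  proof (intro ballI impI)
    fix c assume "\<exists>a\<in>UNIV. g = c * a" "\<exists>b\<in>UNIV. h = c * b"
    then obtain a b where ab: "g = c * a" "h = c * b" by blast
    have "\<not> a dvd 1"
    proof
      assume "a dvd 1"
      then obtain v where v: "1 = a * v" by (rule dvdE)
      have "c = g * v" unfolding ab(1) mult.assoc v[symmetric] by simp
      then have "g dvd c" by (rule dvdI)
      then have "g dvd h" unfolding ab(2) by (rule dvd_mult2)
      then show False using h by blast
    qed
    then have "c dvd 1" using irreducibleD[OF g ab(1)] by blast
    then obtain d where "1 = c * d" by (rule dvdE)
    then show "\<exists>d\<in>UNIV. c * d = 1" by (metis UNIV_I)
  qed
qed auto

text \<open>
  A common divisor of \<open>P\<close> and \<open>Q\<close> divides \<open>x\<^sup>n\<close> and \<open>y\<^sup>n\<close>, and so it is a unit.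
\<close>

lemma irreducible_not_dvd_both:
  assumes "irreducible g" "m_primary (ideal_generated {P, Q})"
  shows "\<not> (g dvd P \<and> g dvd Q)"
proof
  assume dvd: "g dvd P \<and> g dvd Q"
  have *: "w \<in> ideal_generated {P, Q} \<Longrightarrow> g dvd w * 1" for w
    using dvd unfolding ideal_generated_2 by auto
  obtain n where "var_x ^ n \<in> ideal_generated {P, Q}" "var_y ^ n \<in> ideal_generated {P, Q}"
    using assms(2) unfolding m_primary_def by blast
  then have "g dvd var_x ^ n * 1" "g dvd var_y ^ n * 1" by (auto dest: *)
  then have "g dvd 1" by (rule dvd_of_dvd_var_x_var_y_multiples)
  then show False using assms(1) by (simp add: irreducible_def)
qed

text \<open>
  Modulo \<open>g\<close>, the Leibniz rule gives \<open>P (g k)\<^sub>y - Q (g k)\<^sub>x = k (P g\<^sub>y - Q g\<^sub>x)\<close>, and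
  \<open>k\<close> can be cancelled.
\<close>

lemma invariant_factor:
  assumes inv: "invariant_curve P Q (g * k)" and prim: "m_primary (ideal_generated {g, k})"
  shows "g dvd P * deriv_y g - Q * deriv_x g"
proof -
  obtain h where h: "P * deriv_y (g * k) - Q * deriv_x (g * k) = g * k * h"
    using inv unfolding invariant_curve_def by blast
  have "k * (P * deriv_y g - Q * deriv_x g) =
      (P * deriv_y (g * k) - Q * deriv_x (g * k)) - g * (P * deriv_y k - Q * deriv_x k)"
    unfolding deriv_x_mult deriv_y_mult by algebra
  also have "\<dots> = g * (k * h - (P * deriv_y k - Q * deriv_x k))"
    unfolding h right_diff_distrib by (simp only: mult.assoc)
  finally have "g dvd k * (P * deriv_y g - Q * deriv_x g)" by (rule dvdI)
  then show ?thesis by (rule dvd_of_dvd_mult_m_primary[OF prim])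
qed

text \<open>
  The formula of Gomez-Mont in algebraic form: the difference of the two Tjurina numbers is a difference
  of intersection multiplicities. It is \<open>quotient_dim_exchange\<close> for the vectors \<open>(P + t Q, Q)\<close> and
  \<open>(\<partial>\<^sub>x F + t \<partial>\<^sub>y F, \<partial>\<^sub>y F)\<close>, which are proportional modulo \<open>F\<close> by invariance.
\<close>

lemma tjurina_exchange:
  assumes inv: "F dvd P * deriv_y F - Q * deriv_x F"
    and prim: "m_primary (ideal_generated {F, P + const2 t * Q})"
      "m_primary (ideal_generated {F, directional t F})"
  shows "intersection_multiplicity F (P + const2 t * Q) + tjurina_curve F
    = intersection_multiplicity F (directional t F) + tjurina_foliation P Q F"
proof -
  have comb: "ideal_generated {F, A + c * B, B} = ideal_generated {A, B, F}" for A B c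
  proof (intro set_eqI iffI)
    fix z assume "z \<in> ideal_generated {F, A + c * B, B}"
    then obtain p q s where "z = p * F + q * (A + c * B) + s * B" unfolding ideal_generated_3 by blast
    then have "z = q * A + (q * c + s) * B + p * F" by algebra
    then show "z \<in> ideal_generated {A, B, F}" unfolding ideal_generated_3 by blast
  next
    fix z assume "z \<in> ideal_generated {A, B, F}"
    then obtain p q s where "z = p * A + q * B + s * F" unfolding ideal_generated_3 by blast
    then have "z = s * F + p * (A + c * B) + (q - p * c) * B" by algebra
    then show "z \<in> ideal_generated {F, A + c * B, B}" unfolding ideal_generated_3 by blast
  qed
  have "Q * directional t F - (P + const2 t * Q) * deriv_y F = - (P * deriv_y F - Q * deriv_x F)"
    unfolding directional_def by algebra
  then have "F dvd Q * directional t F - (P + const2 t * Q) * deriv_y F"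
    using inv by (simp only: dvd_minus_iff)
  from quotient_dim_exchange[OF prim this]
  have "intersection_multiplicity F (P + const2 t * Q)
      + quotient_dim (ideal_generated {F, directional t F, deriv_y F})
    = intersection_multiplicity F (directional t F)
      + quotient_dim (ideal_generated {F, P + const2 t * Q, Q})" .
  moreover have "{deriv_x F, deriv_y F, F} = {F, deriv_x F, deriv_y F}" by blast
  ultimately show ?thesis
    unfolding directional_def comb tjurina_curve_def tjurina_foliation_def by simp
qed

section \<open>Decomposition into components\<close>

lemma sum_ordered_pairs:
  fixes h :: "nat \<Rightarrow> nat \<Rightarrow> int"
  assumes sym: "\<And>i j. h i j = h j i"
  shows "(\<Sum>j=1..r. \<Sum>i\<in>{1..r} - {j}. h i j) = 2 * (\<Sum>(i, j)\<in>{(i, j). 1 \<le> i \<and> i < j \<and> j \<le> r}. h i j)"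
proof -
  let ?L = "{(i, j). 1 \<le> i \<and> i < j \<and> j \<le> r}" and ?G = "{(i, j). 1 \<le> j \<and> j < i \<and> i \<le> r}"
  have fin: "finite ?L" "finite ?G"
    by (rule finite_subset[of _ "{1..r} \<times> {1..r}"]; auto)+
  have "(\<Sum>j=1..r. \<Sum>i\<in>{1..r} - {j}. h i j) = (\<Sum>(j, i)\<in>Sigma {1..r} (\<lambda>j. {1..r} - {j}). h i j)"
    by (rule sum.Sigma) auto
  also have "Sigma {1..r} (\<lambda>j. {1..r} - {j}) = ?L \<union> ?G" by auto
  also have "(\<Sum>(j, i)\<in>?L \<union> ?G. h i j) = (\<Sum>(j, i)\<in>?L. h i j) + (\<Sum>(j, i)\<in>?G. h i j)"
    by (rule sum.union_disjoint) (use fin in auto)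
  also have "(\<Sum>(j, i)\<in>?G. h i j) = (\<Sum>(i, j)\<in>?L. h i j)"
    by (rule sum.reindex_bij_witness[of _ prod.swap prod.swap]) auto
  also have "(\<Sum>(j, i)\<in>?L. h i j) = (\<Sum>(i, j)\<in>?L. h i j)"
    by (rule sum.cong) (auto simp: sym)
  finally show ?thesis by simp
qed

text \<open>
  Otherwise the square of \<open>C i\<close> would divide \<open>f\<close>.
\<close>

lemma irreducible_components_not_dvd:
  fixes f :: series2 and r :: nat
  assumes sf: "squarefree f" and irr: "\<And>j. j \<in> {1..r} \<Longrightarrow> irreducible (C j)"
    and f: "f = u * (\<Prod>j=1..r. C j)" and ij: "i \<in> {1..r}" "j \<in> {1..r}" "i \<noteq> j"
  shows "\<not> C i dvd C j"
proof
  assume "C i dvd C j"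
  then obtain k where k: "C j = C i * k" by (rule dvdE)
  have "(\<Prod>j=1..r. C j) = C i * (\<Prod>l\<in>{1..r} - {i}. C l)"
    using ij(1) by (intro prod.remove) auto
  also have "(\<Prod>l\<in>{1..r} - {i}. C l) = C j * (\<Prod>l\<in>{1..r} - {i} - {j}. C l)"
    using ij by (intro prod.remove) auto
  finally have "(\<Prod>j=1..r. C j) = C i * (C j * (\<Prod>l\<in>{1..r} - {i} - {j}. C l))" .
  then have "f = (C i)\<^sup>2 * (u * k * (\<Prod>l\<in>{1..r} - {i} - {j}. C l))"
    unfolding f k power2_eq_square by algebra
  then have "(C i)\<^sup>2 dvd f" by (rule dvdI)
  then have "C i dvd 1" using sf unfolding squarefree_def by blast
  then show False using irr[OF ij(1)] by (simp add: irreducible_def)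
qed

theorem proposition3p1:
  fixes P Q f :: series2 and r :: nat and C :: "nat \<Rightarrow> series2"
  assumes "singular_foliation P Q"
    and "reduced_curve f"
    and "invariant_curve P Q f"
    and "irreducible_components f r C"
  shows "int (tjurina_foliation P Q f) =
      (\<Sum>j=1..r. int (tjurina_foliation P Q (C j))) -
      (\<Sum>(i, j)\<in>{(i, j). 1 \<le> i \<and> i < j \<and> j \<le> r}. int (intersection_multiplicity (C i) (C j))) +
      Theta f r C"
proof -
  let ?R = "{1..r}" and ?I = intersection_multiplicity
  have sf: "squarefree f" using assms(2) by (simp add: reduced_curve_def)
  have irr: "irreducible (C j)" if "j \<in> ?R" for j
    using assms(4) that unfolding irreducible_components_def by blast
  obtain u where u: "u dvd 1" and f: "f = u * (\<Prod>j=1..r. C j)"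
    using assms(4) unfolding irreducible_components_def by blast
  have nz: "C j \<noteq> 0" if "j \<in> ?R" for j using irr[OF that] by (simp add: irreducible_def)
  have PQ: "m_primary (ideal_generated {P, Q})"
    using assms(1) unfolding singular_foliation_def by (blast intro: conv.m_primary_of_relatively_prime)
  have CC: "m_primary (ideal_generated {C i, C j})" if "i \<in> ?R" "j \<in> ?R" "i \<noteq> j" for i j
    using irreducible_components_not_dvd[OF sf irr f that] m_primary_irreducible[OF irr[OF that(1)]] by blast
  define k where "k j = (\<Prod>i\<in>?R - {j}. C i) * u" for j
  have fk: "f = C j * k j" if "j \<in> ?R" for j
  proof -
    have "(\<Prod>i=1..r. C i) = C j * (\<Prod>i\<in>?R - {j}. C i)" using that by (intro prod.remove) auto
    then show ?thesis unfolding f k_def by algebra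
  qed
  have kc: "m_primary (ideal_generated {(\<Prod>i\<in>?R - {j}. C i) * b, C j})
      \<and> ?I ((\<Prod>i\<in>?R - {j}. C i) * b) (C j) = (\<Sum>i\<in>?R - {j}. ?I (C i) (C j)) + ?I b (C j)"
    if "j \<in> ?R" "m_primary (ideal_generated {b, C j})" for j b
    using that by (intro intersection_multiplicity_prod nz CC) auto
  have Ck: "m_primary (ideal_generated {C j, k j})" if "j \<in> ?R" for j
    using kc[OF that m_primary_unit[OF u]] unfolding k_def by (simp only: insert_commute)
  have invC: "C j dvd P * deriv_y (C j) - Q * deriv_x (C j)" if "j \<in> ?R" for j
    using assms(3) Ck[OF that] unfolding fk[OF that] by (rule invariant_factor)
  have invf: "f dvd P * deriv_y f - Q * deriv_x f"
    using assms(3) unfolding invariant_curve_def by (metis dvdI)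
  \<comment> \<open>one direction that is good for all components at once\<close>
  have "finite (\<Union>j\<in>?R. {t. C j dvd directional t (C j)})"
    by (intro finite_UN_I finite_bad_directions irr) auto
  from ex_new_if_finite[OF infinite_UNIV_char_0 this]
  obtain t where "t \<notin> (\<Union>j\<in>?R. {t. C j dvd directional t (C j)})" ..
  then have t: "\<not> C j dvd directional t (C j)" if "j \<in> ?R" for j using that by blast
  define q where "q = P + const2 t * Q"
  have CD: "m_primary (ideal_generated {C j, directional t (C j)})" if "j \<in> ?R" for j
    by (rule m_primary_irreducible[OF irr[OF that] t[OF that]])
  have Cq: "m_primary (ideal_generated {C j, q})" if "j \<in> ?R" for j
  proof (rule m_primary_irreducible[OF irr[OF that]], rule notI)
    assume dvd: "C j dvd q"
    \<comment> \<open>by invariance \<open>C j\<close> would divide \<open>Q\<close>, hence both \<open>P\<close> and \<open>Q\<close>\<close>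
    have "directional t (C j) * Q = q * deriv_y (C j) - (P * deriv_y (C j) - Q * deriv_x (C j))"
      unfolding q_def directional_def by algebra
    also have "C j dvd \<dots>" by (intro dvd_diff dvd_mult2 dvd invC that)
    finally have Q: "C j dvd Q" by (rule dvd_of_dvd_mult_m_primary[OF CD[OF that]])
    have "P = q - const2 t * Q" unfolding q_def by algebra
    also have "C j dvd \<dots>" by (intro dvd_diff dvd dvd_mult Q)
    finally show False using Q irreducible_not_dvd_both[OF irr[OF that] PQ] by blast
  qed
  have fprod: "f = (\<Prod>j\<in>?R. C j) * u" unfolding f by (rule mult.commute)
  have prod: "m_primary (ideal_generated {f, c}) \<and> ?I f c = (\<Sum>j=1..r. ?I (C j) c)"
    if "\<And>j. j \<in> ?R \<Longrightarrow> m_primary (ideal_generated {C j, c})" for c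
    using intersection_multiplicity_prod[OF finite_atLeastAtMost nz that m_primary_unit[OF u]]
    unfolding fprod intersection_multiplicity_unit[OF u] by simp
  have Df: "m_primary (ideal_generated {C j, directional t f})
      \<and> ?I (C j) (directional t f) = (\<Sum>i\<in>?R - {j}. ?I (C i) (C j)) + ?I (C j) (directional t (C j))"
    if j: "j \<in> ?R" for j
  proof -
    let ?d = "u * directional t (C j)" and ?D = "directional t (C j)"
    \<comment> \<open>modulo \<open>C j\<close> only one term of the Leibniz expansion of \<open>D f\<close> survives\<close>
    have "directional t f - k j * ?D = C j * directional t (k j)"
      unfolding fk[OF j] directional_mult by algebra
    then have "C j dvd directional t f - k j * ?D" by (rule dvdI)
    then have eq: "ideal_generated {C j, directional t f} = ideal_generated {(\<Prod>i\<in>?R - {j}. C i) * ?d, C j}"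
      unfolding k_def mult.assoc by (simp only: ideal_generated_cong_dvd insert_commute)
    have DC: "m_primary (ideal_generated {?D, C j})" using CD[OF j] by (simp only: insert_commute)
    have "u \<noteq> 0" using u by auto
    note d = m_primary_mult[OF m_primary_unit[OF u] DC]
      intersection_multiplicity_mult[OF \<open>u \<noteq> 0\<close> m_primary_unit[OF u] DC]
    have "?I (C j) (directional t f) = ?I ((\<Prod>i\<in>?R - {j}. C i) * ?d) (C j)"
      unfolding intersection_multiplicity_def eq ..
    then show ?thesis
      using kc[OF j d(1)] d(2) unfolding eq intersection_multiplicity_unit[OF u]
      by (simp add: intersection_multiplicity_commute[of ?D])
  qed
  note pq = prod[OF Cq] and pD = prod[OF Df[THEN conjunct1]]
  have "?I f q + tjurina_curve f = ?I f (directional t f) + tjurina_foliation P Q f"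
    using tjurina_exchange[OF invf] pq pD unfolding q_def by blast
  then have 1: "(\<Sum>j=1..r. ?I (C j) q) + tjurina_curve f
      = (\<Sum>j=1..r. ?I (C j) (directional t f)) + tjurina_foliation P Q f"
    using pq pD by simp
  have 2: "(\<Sum>j=1..r. ?I (C j) (directional t f))
      = (\<Sum>j=1..r. \<Sum>i\<in>?R - {j}. ?I (C i) (C j)) + (\<Sum>j=1..r. ?I (C j) (directional t (C j)))"
    unfolding sum.distrib[symmetric] by (intro sum.cong refl Df[THEN conjunct2])
  have 3: "(\<Sum>j=1..r. ?I (C j) q) + (\<Sum>j=1..r. tjurina_curve (C j))
      = (\<Sum>j=1..r. ?I (C j) (directional t (C j))) + (\<Sum>j=1..r. tjurina_foliation P Q (C j))"
    unfolding sum.distrib[symmetric] q_def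
    by (intro sum.cong refl tjurina_exchange invC CD Cq[unfolded q_def])
  have 4: "int (\<Sum>j=1..r. \<Sum>i\<in>?R - {j}. ?I (C i) (C j))
      = 2 * (\<Sum>(i, j)\<in>{(i, j). 1 \<le> i \<and> i < j \<and> j \<le> r}. int (?I (C i) (C j)))"
    using sum_ordered_pairs[of "\<lambda>i j. int (?I (C i) (C j))" r] intersection_multiplicity_commute by simp
  have "Theta f r C = int (tjurina_curve f) - (\<Sum>j=1..r. int (tjurina_curve (C j)))
      - (\<Sum>(i, j)\<in>{(i, j). 1 \<le> i \<and> i < j \<and> j \<le> r}. int (?I (C i) (C j)))"
    unfolding Theta_def by (rule the_equality) simp_all
  then show ?thesis using 4 arg_cong[OF 1, of int] arg_cong[OF 2, of int] arg_cong[OF 3, of int]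
    unfolding of_nat_add of_nat_sum by linarith
qed

end
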